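(* If $G$ is of type $G_2$, then semisimple elements of $\tilde G$ are conjugate in $\tilde G$ if and only if they are conjugate in $\operatorname{GL}(V(\lambda_k))$ up to a constant for $k=1,2$.
   Context: $G$ is the complex semisimple algebraic group of adjoint type $G_2$, $\tilde G$ its simply connected cover, and $V(\lambda_1),V(\lambda_2)$ are the two fundamental representations of $\tilde G$. Elements $s_1,s_2\in\tilde G$ are "conjugate in $\operatorname{GL}(V)$ up to a constant" if the image of $s_1$ in $\operatorname{GL}(V)$ is conjugate to $t$ times the image of $s_2$ for some $t\in\mathbb C^*$ (which may depend on $V$). *)

theory Defs
  imports "HOL-Analysis.Analysis"
begin

section \<open>Linear algebraic groups, their rational representations, semisimple elements\<close>

text \<open>The coordinate ring of \<open>GL\<^sub>n\<close> over the complex numbers: polynomials in the matrix entries and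
  the inverse of the determinant. For a Zariski-closed subgroup \<open>G\<close> of \<open>GL\<^sub>n\<close>, the regular functions
  on \<open>G\<close> are the restrictions of these.\<close>

inductive regular_fun :: "(complex^'n^'n \<Rightarrow> complex) \<Rightarrow> bool" where
  regular_const: "regular_fun (\<lambda>A. c)"
| regular_entry: "regular_fun (\<lambda>A. A $ i $ j)"
| regular_inv_det: "regular_fun (\<lambda>A. inverse (det A))"
| regular_add: "regular_fun f \<Longrightarrow> regular_fun g \<Longrightarrow> regular_fun (\<lambda>A. f A + g A)"
| regular_mult: "regular_fun f \<Longrightarrow> regular_fun g \<Longrightarrow> regular_fun (\<lambda>A. f A * g A)"

definition rational_rep ::
  "(complex^'n^'n) set \<Rightarrow> (complex^'n^'n \<Rightarrow> complex^'m^'m) \<Rightarrow> bool" where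
  "rational_rep G \<rho> \<longleftrightarrow>
     \<rho> (mat 1) = mat 1 \<and>
     (\<forall>A\<in>G. \<forall>B\<in>G. \<rho> (A ** B) = \<rho> A ** \<rho> B) \<and>
     (\<forall>i j. \<exists>f. regular_fun f \<and> (\<forall>A\<in>G. \<rho> A $ i $ j = f A))"

definition irreducible_rep ::
  "(complex^'n^'n) set \<Rightarrow> (complex^'n^'n \<Rightarrow> complex^'m^'m) \<Rightarrow> bool" where
  "irreducible_rep G \<rho> \<longleftrightarrow>
     (\<forall>W. vec.subspace W \<and> (\<forall>A\<in>G. \<forall>w\<in>W. \<rho> A *v w \<in> W) \<longrightarrow> W = {0} \<or> W = UNIV)"

definition diagonal_matrix :: "complex^'n^'n \<Rightarrow> bool" where
  "diagonal_matrix D \<longleftrightarrow> (\<forall>i j. i \<noteq> j \<longrightarrow> D $ i $ j = 0)"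

definition semisimple_elt :: "complex^'n^'n \<Rightarrow> bool" where
  "semisimple_elt A \<longleftrightarrow>
     (\<exists>P D :: complex^'n^'n. invertible P \<and> diagonal_matrix D \<and> A = P ** D ** matrix_inv P)"

definition conjugate_in :: "(complex^'n^'n) set \<Rightarrow> complex^'n^'n \<Rightarrow> complex^'n^'n \<Rightarrow> bool" where
  "conjugate_in G A B \<longleftrightarrow> (\<exists>P\<in>G. A = P ** B ** matrix_inv P)"

definition GL :: "(complex^'n^'n) set" where
  "GL = {A. invertible A}"

definition conjugate_GL_up_to_const :: "complex^'n^'n \<Rightarrow> complex^'n^'n \<Rightarrow> bool" where
  "conjugate_GL_up_to_const A B \<longleftrightarrow> (\<exists>t. t \<noteq> 0 \<and> conjugate_in GL A (mat t ** B))"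


section \<open>The group of type \<open>G\<^sub>2\<close>\<close>

text \<open>The complex octonions as Zorn's algebra of vector matrices
  \<open>(a u; v b)\<close>, where \<open>a, b\<close> are complex numbers and \<open>u, v\<close> are vectors in complex 3-space. The coordinate
  \<open>E1\<close> holds \<open>a\<close>, \<open>E2\<close> holds \<open>b\<close>, and \<open>Ui\<close>, \<open>Vi\<close> hold the components of \<open>u\<close> and \<open>v\<close>.\<close>

datatype oct_index = E1 | E2 | U1 | U2 | U3 | V1 | V2 | V3

lemma UNIV_oct_index: "UNIV = {E1, E2, U1, U2, U3, V1, V2, V3}"
proof -
  have "x \<in> {E1, E2, U1, U2, U3, V1, V2, V3}" for x
    by (cases x) auto
  then show ?thesis by blast
qed

instance oct_index :: finite
  by standard (simp add: UNIV_oct_index)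

type_synonym octonion = "complex^oct_index"
type_synonym oct_matrix = "complex^oct_index^oct_index"

text \<open>The arguments are listed in the order \<open>a\<close>, \<open>u\<close>, \<open>v\<close>, \<open>b\<close>.\<close>

definition oct :: "complex \<Rightarrow> complex \<Rightarrow> complex \<Rightarrow> complex \<Rightarrow>
    complex \<Rightarrow> complex \<Rightarrow> complex \<Rightarrow> complex \<Rightarrow> octonion" where
  "oct a u1 u2 u3 v1 v2 v3 b = (\<chi> i. case i of
     E1 \<Rightarrow> a | E2 \<Rightarrow> b | U1 \<Rightarrow> u1 | U2 \<Rightarrow> u2 | U3 \<Rightarrow> u3 | V1 \<Rightarrow> v1 | V2 \<Rightarrow> v2 | V3 \<Rightarrow> v3)"

text \<open>Zorn's product: with the bilinear dot product and the cross product on complex 3-space,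
  \<open>(a u; v b) (a' u'; v' b') = (a a' + u\<cdot>v'   a u' + b' u - v\<times>v';  a' v + b v' + u\<times>u'   b b' + v\<cdot>u')\<close>.\<close>

definition oct_mult :: "octonion \<Rightarrow> octonion \<Rightarrow> octonion" (infixl "\<star>" 70) where
  "x \<star> y = oct
     (x$E1 * y$E1 + (x$U1 * y$V1 + x$U2 * y$V2 + x$U3 * y$V3))
     (x$E1 * y$U1 + y$E2 * x$U1 - (x$V2 * y$V3 - x$V3 * y$V2))
     (x$E1 * y$U2 + y$E2 * x$U2 - (x$V3 * y$V1 - x$V1 * y$V3))
     (x$E1 * y$U3 + y$E2 * x$U3 - (x$V1 * y$V2 - x$V2 * y$V1))
     (y$E1 * x$V1 + x$E2 * y$V1 + (x$U2 * y$U3 - x$U3 * y$U2))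
     (y$E1 * x$V2 + x$E2 * y$V2 + (x$U3 * y$U1 - x$U1 * y$U3))
     (y$E1 * x$V3 + x$E2 * y$V3 + (x$U1 * y$U2 - x$U2 * y$U1))
     (x$E2 * y$E2 + (x$V1 * y$U1 + x$V2 * y$U2 + x$V3 * y$U3))"

definition oct_norm :: "octonion \<Rightarrow> complex" where
  "oct_norm x = x$E1 * x$E2 - (x$U1 * x$V1 + x$U2 * x$V2 + x$U3 * x$V3)"

text \<open>The algebraic group of type \<open>G\<^sub>2\<close>, realised as the automorphism group of the complex octonions,
  a closed subgroup of \<open>GL\<^sub>8\<close>. In type \<open>G\<^sub>2\<close> the root lattice is the weight lattice, so the adjoint
  group and its simply connected cover are both this group.\<close>

definition G2 :: "oct_matrix set" where
  "G2 = {A. invertible A \<and> (\<forall>x y. A *v (x \<star> y) = (A *v x) \<star> (A *v y))}"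

text \<open>Choice of maximal torus and Borel subgroup. The torus acts on the coordinates \<open>Ui\<close> by \<open>t\<^sub>i\<close> and on
  \<open>Vi\<close> by \<open>1/t\<^sub>i\<close>, where \<open>t\<^sub>1 t\<^sub>2 t\<^sub>3 = 1\<close>; write \<open>\<epsilon>\<^sub>i\<close> for the character \<open>t\<^sub>i\<close>. The roots are
  \<open>\<plusminus>\<epsilon>\<^sub>i\<close> (short) and \<open>\<epsilon>\<^sub>i - \<epsilon>\<^sub>j\<close> (long). The simple roots are \<open>\<alpha>\<^sub>1 = \<epsilon>\<^sub>2\<close> and \<open>\<alpha>\<^sub>2 = \<epsilon>\<^sub>1 - \<epsilon>\<^sub>2\<close>.

  The simple root subgroups below are \<open>z \<mapsto> exp (z e\<^sub>j)\<close> for root vectors \<open>e\<^sub>j\<close> in the derivation algebra.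
  Together with the simple coroots they generate the Borel subgroup: the simple root subgroups generate
  its unipotent radical and, the group being simply connected, the coroots generate the torus.\<close>

definition simple_root_elt :: "nat \<Rightarrow> complex \<Rightarrow> oct_matrix" where
  "simple_root_elt j z = matrix (\<lambda>x.
     if j = 1 then
       oct (x$E1 + z * x$V2)
           (x$U1) (x$U2 - z * x$E1 + z * x$E2 - z^2 * x$V2) (x$U3)
           (x$V1 - z * x$U3) (x$V2) (x$V3 + z * x$U1)
           (x$E2 - z * x$V2)
     else
       oct (x$E1)
           (x$U1 + z * x$U2) (x$U2) (x$U3)
           (x$V1) (x$V2 - z * x$V1) (x$V3)
           (x$E2))"

definition torus_elt :: "complex \<Rightarrow> complex \<Rightarrow> complex \<Rightarrow> oct_matrix" where
  "torus_elt t1 t2 t3 = matrix (\<lambda>x.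
     oct (x$E1) (t1 * x$U1) (t2 * x$U2) (t3 * x$U3) (x$V1 / t1) (x$V2 / t2) (x$V3 / t3) (x$E2))"

definition simple_coroot :: "nat \<Rightarrow> complex \<Rightarrow> oct_matrix" where
  "simple_coroot j z =
     (if j = 1 then torus_elt (inverse z) (z^2) (inverse z) else torus_elt z (inverse z) 1)"

text \<open>A highest weight vector is an eigenvector of the Borel subgroup; its weight \<open>\<lambda>\<close> is determined by
  the integers \<open>c j = \<langle>\<lambda>, \<alpha>\<^sub>j\<^sup>\<or>\<rangle>\<close>. Irreducible rational representations have exactly one
  highest weight and are determined by it up to isomorphism.\<close>

definition has_highest_weight :: "(oct_matrix \<Rightarrow> complex^'m^'m) \<Rightarrow> (nat \<Rightarrow> int) \<Rightarrow> bool" where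
  "has_highest_weight \<rho> c \<longleftrightarrow>
     (\<exists>v. v \<noteq> 0 \<and> (\<forall>j\<in>{1, 2}.
        (\<forall>z. \<rho> (simple_root_elt j z) *v v = v) \<and>
        (\<forall>z. z \<noteq> 0 \<longrightarrow> \<rho> (simple_coroot j z) *v v = (z powi c j) *s v)))"

definition fundamental_weight :: "nat \<Rightarrow> nat \<Rightarrow> int" where
  "fundamental_weight k j = (if j = k then 1 else 0)"

definition fundamental_rep :: "nat \<Rightarrow> (oct_matrix \<Rightarrow> complex^'m^'m) \<Rightarrow> bool" where
  "fundamental_rep k \<rho> \<longleftrightarrow>
     rational_rep G2 \<rho> \<and> irreducible_rep G2 \<rho> \<and> has_highest_weight \<rho> (fundamental_weight k)"


subsection \<open>Consistency of the model\<close>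

lemma oct_nth [simp]:
  "oct a u1 u2 u3 v1 v2 v3 b $ E1 = a" "oct a u1 u2 u3 v1 v2 v3 b $ E2 = b"
  "oct a u1 u2 u3 v1 v2 v3 b $ U1 = u1" "oct a u1 u2 u3 v1 v2 v3 b $ U2 = u2"
  "oct a u1 u2 u3 v1 v2 v3 b $ U3 = u3" "oct a u1 u2 u3 v1 v2 v3 b $ V1 = v1"
  "oct a u1 u2 u3 v1 v2 v3 b $ V2 = v2" "oct a u1 u2 u3 v1 v2 v3 b $ V3 = v3"
  by (simp_all add: oct_def)

lemma oct_eq_iff:
  "x = y \<longleftrightarrow> x$E1 = y$E1 \<and> x$E2 = y$E2 \<and> x$U1 = y$U1 \<and> x$U2 = y$U2 \<and> x$U3 = y$U3 \<and>
     x$V1 = y$V1 \<and> x$V2 = y$V2 \<and> x$V3 = (y::octonion)$V3"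
proof -
  have "(\<forall>i. P i) \<longleftrightarrow> P E1 \<and> P E2 \<and> P U1 \<and> P U2 \<and> P U3 \<and> P V1 \<and> P V2 \<and> P V3" for P
    using UNIV_oct_index by (metis UNIV_I empty_iff insert_iff)
  then show ?thesis unfolding vec_eq_iff .
qed

lemma oct_norm_mult: "oct_norm (x \<star> y) = oct_norm x * oct_norm y"
  unfolding oct_norm_def oct_mult_def oct_nth by (simp add: algebra_simps)

lemma linear_iff_oct:
  "Vector_Spaces.linear (*s) (*s) f \<longleftrightarrow>
     (\<forall>x y. f (x + y) = f x + f y) \<and> (\<forall>c x. f (c *s x) = c *s f x)"
  for f :: "octonion \<Rightarrow> octonion"
  by (simp add: Vector_Spaces.linear_iff vec.vector_space_axioms)

lemma simple_root_elt_works: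
  "simple_root_elt j z *v x =
     (if j = 1 then
       oct (x$E1 + z * x$V2)
           (x$U1) (x$U2 - z * x$E1 + z * x$E2 - z^2 * x$V2) (x$U3)
           (x$V1 - z * x$U3) (x$V2) (x$V3 + z * x$U1)
           (x$E2 - z * x$V2)
     else
       oct (x$E1)
           (x$U1 + z * x$U2) (x$U2) (x$U3)
           (x$V1) (x$V2 - z * x$V1) (x$V3)
           (x$E2))"
  unfolding simple_root_elt_def
  by (subst matrix_works) (auto simp: linear_iff_oct oct_eq_iff algebra_simps)

lemma torus_elt_works:
  "torus_elt t1 t2 t3 *v x =
     oct (x$E1) (t1 * x$U1) (t2 * x$U2) (t3 * x$U3) (x$V1 / t1) (x$V2 / t2) (x$V3 / t3) (x$E2)"
  unfolding torus_elt_def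
  by (subst matrix_works) (auto simp: linear_iff_oct oct_eq_iff algebra_simps add_divide_distrib)

lemma simple_root_elt_add: "simple_root_elt j z ** simple_root_elt j w = simple_root_elt j (z + w)"
  unfolding matrix_eq
  by (auto simp: matrix_vector_mul_assoc [symmetric] simple_root_elt_works oct_eq_iff
        algebra_simps power2_eq_square)

lemma simple_root_elt_0: "simple_root_elt j 0 = mat 1"
  unfolding matrix_eq by (auto simp: simple_root_elt_works oct_eq_iff)

lemma simple_root_elt_in_G2: "simple_root_elt j z \<in> G2"
proof -
  have "invertible (simple_root_elt j z)"
    unfolding invertible_def
    by (rule exI [of _ "simple_root_elt j (- z)"]) (simp add: simple_root_elt_add simple_root_elt_0)
  then show ?thesis
    by (auto simp: G2_def simple_root_elt_works oct_eq_iff oct_mult_def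
          algebra_simps power2_eq_square)
qed

lemma torus_elt_mult:
  "torus_elt t1 t2 t3 ** torus_elt r1 r2 r3 = torus_elt (t1 * r1) (t2 * r2) (t3 * r3)"
  unfolding matrix_eq
  by (auto simp: matrix_vector_mul_assoc [symmetric] torus_elt_works oct_eq_iff)

lemma torus_elt_1: "torus_elt 1 1 1 = mat 1"
  unfolding matrix_eq by (auto simp: torus_elt_works oct_eq_iff)

lemma torus_elt_in_G2:
  assumes "t1 * t2 * t3 = 1"
  shows "torus_elt t1 t2 t3 \<in> G2"
proof -
  have nz: "t1 \<noteq> 0" "t2 \<noteq> 0" "t3 \<noteq> 0" using assms by auto
  have t3: "t3 = 1 / (t1 * t2)" using assms nz by (simp add: field_simps)
  have "invertible (torus_elt t1 t2 t3)"
    unfolding invertible_def using nz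
    by (intro exI [of _ "torus_elt (1 / t1) (1 / t2) (1 / t3)"]) (simp add: torus_elt_mult torus_elt_1)
  then show ?thesis using nz
    by (auto simp: G2_def torus_elt_works oct_eq_iff oct_mult_def t3 field_simps)
qed

lemma simple_coroot_in_G2: "z \<noteq> 0 \<Longrightarrow> simple_coroot j z \<in> G2"
  unfolding simple_coroot_def
  by (auto intro!: torus_elt_in_G2 simp: power2_eq_square field_simps)

text \<open>The Cartan integers \<open>\<langle>\<alpha>\<^sub>j, \<alpha>\<^sub>i\<^sup>\<or>\<rangle>\<close> of type \<open>G\<^sub>2\<close>.\<close>

lemma simple_coroot_root_elt:
  assumes "z \<noteq> 0" "i \<in> {1, 2}" "j \<in> {1, 2}"
  shows "simple_coroot i z ** simple_root_elt j w =
    simple_root_elt j ((z powi (if i = j then 2 else if i = 1 then - 3 else - 1)) * w) ** simple_coroot i z"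
  using assms unfolding matrix_eq
  by (auto simp: matrix_vector_mul_assoc [symmetric] simple_root_elt_works torus_elt_works
        simple_coroot_def oct_eq_iff power_int_def field_simps power2_eq_square power3_eq_cube)

text \<open>The 7-dimensional representation on the octonions of trace zero has highest weight \<open>\<lambda>\<^sub>1 = - \<epsilon>\<^sub>3\<close>.\<close>

lemma axis_V3_highest_weight:
  fixes v :: octonion
  defines "v \<equiv> oct 0 0 0 0 0 0 1 0"
  assumes "j \<in> {1, 2}"
  shows "simple_root_elt j z *v v = v"
    and "z \<noteq> 0 \<Longrightarrow> simple_coroot j z *v v = (z powi fundamental_weight 1 j) *s v"
  using assms
  by (auto simp: simple_root_elt_works torus_elt_works simple_coroot_def fundamental_weight_def oct_eq_iff field_simps)

end

theory Submission
  imports Defs "HOL-Computational_Algebra.Polynomial"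
begin

text \<open>A conjugacy in the group induces one in every representation, with constant \<open>1\<close>
(\<open>rational_rep_conjugate\<close>). For the converse, the class of a semisimple element \<open>s\<close> is recovered from the
traces of \<open>s\<close> and \<open>s\<^sup>2\<close> on \<open>V(\<lambda>\<^sub>1)\<close>. Three facts carry the argument.

First, \<open>s\<close> is conjugate to some \<open>torus_elt t\<^sub>1 t\<^sub>2 t\<^sub>3\<close> with \<open>t\<^sub>1 t\<^sub>2 t\<^sub>3 = 1\<close> (\<open>semisimple_conj_torus\<close>): it fixes
an octonion of trace \<open>1\<close> and norm \<open>0\<close>, all of these are conjugate to the idempotent \<open>E1\<close>, and the
stabiliser of \<open>E1\<close> is \<open>SL\<^sub>3\<close>, where \<open>s\<close> can be diagonalised.

Second, an irreducible representation of highest weight \<open>\<lambda>\<^sub>1\<close> is the space of octonions of trace zero,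
hence has dimension \<open>7\<close> and \<open>trace (\<rho> g) = trace g - 1\<close> (\<open>trace_rep\<close>). The nonzero null vectors of
trace zero form the orbit of the highest weight vector \<open>V3\<close>. The stabiliser of \<open>V3\<close> fixes the highest
weight vector \<open>v0\<close> of \<open>\<rho>\<close> (\<open>hwv_stabiliser\<close>), so \<open>g V3 \<mapsto> \<rho> g v0\<close> is a well-defined map on null
vectors. If \<open>x\<close> and \<open>y\<close> span a plane of null vectors, conjugates of opposite root groups move \<open>x\<close> to \<open>x + z y\<close> and \<open>y\<close> to
\<open>y + z x\<close>; so the map is, on \<open>x + z y\<close>, a polynomial \<open>p z\<close> with \<open>p z = z q (1 / z)\<close> for another
polynomial \<open>q\<close>, which forces \<open>p\<close> to be affine (\<open>additive_pair_root_curves\<close>). Such additivity suffices for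
a linear extension (\<open>rep_map\<close>), which is injective on octonions of trace zero and onto by irreducibility.

Third, put \<open>p = t\<^sub>1 + t\<^sub>2 + t\<^sub>3\<close> and \<open>q = 1/t\<^sub>1 + 1/t\<^sub>2 + 1/t\<^sub>3\<close>. On \<open>V(\<lambda>\<^sub>1)\<close> the torus element has trace
\<open>1 + p + q\<close>, and its square has trace \<open>1 + p\<^sup>2 + q\<^sup>2 - 2 (p + q)\<close>. The two traces therefore determine the
unordered pair of \<open>p\<close> and \<open>q\<close>. Since \<open>t\<^sub>1 t\<^sub>2 t\<^sub>3 = 1\<close>, the \<open>t\<^sub>i\<close> are the roots of \<open>X\<^sup>3 - p X\<^sup>2 + q X - 1\<close>, so
they are known up to order and simultaneous inversion, and \<open>G\<^sub>2\<close> realises these changes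
(\<open>semisimple_conj_of_trace_eq\<close>).

It remains to remove the constant \<open>c\<close>. Semisimple elements have determinant \<open>1\<close> on \<open>V(\<lambda>\<^sub>1)\<close>, so
\<open>c\<^sup>7 = 1\<close>. They are conjugate to their inverses, so the traces \<open>x\<^sub>1, x\<^sub>2\<close> of the two elements satisfy
\<open>x\<^sub>1 = c x\<^sub>2 = x\<^sub>2 / c\<close>, and those of their squares satisfy the same with \<open>c\<^sup>2\<close> for \<open>c\<close>. Either the traces
vanish, or \<open>c\<close> is a root of unity of order dividing \<open>4\<close> and of order dividing \<open>7\<close>, that is \<open>c = 1\<close>.\<close>

section \<open>Zorn's vector matrices\<close>

definition dot3 :: "complex^3 \<Rightarrow> complex^3 \<Rightarrow> complex" (infixl "\<odot>" 70) where
  "u \<odot> v = u$1 * v$1 + u$2 * v$2 + u$3 * v$3"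

definition ccross :: "complex^3 \<Rightarrow> complex^3 \<Rightarrow> complex^3" (infixl "\<otimes>" 75) where
  "u \<otimes> v = vector [u$2 * v$3 - u$3 * v$2, u$3 * v$1 - u$1 * v$3, u$1 * v$2 - u$2 * v$1]"

definition vec3 :: "complex \<Rightarrow> complex \<Rightarrow> complex \<Rightarrow> complex^3" where
  "vec3 a b c = vector [a, b, c]"

text \<open>The vector matrix \<open>(a u; v b)\<close>. Its entries as vectors in 3-space turn identities in eight
coordinates into identities between dot and cross products.\<close>

definition zorn :: "complex \<Rightarrow> complex^3 \<Rightarrow> complex^3 \<Rightarrow> complex \<Rightarrow> octonion" where
  "zorn a u v b = oct a (u$1) (u$2) (u$3) (v$1) (v$2) (v$3) b"

abbreviation e1 :: "complex^3" where "e1 \<equiv> vec3 1 0 0"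
abbreviation e2 :: "complex^3" where "e2 \<equiv> vec3 0 1 0"
abbreviation e3 :: "complex^3" where "e3 \<equiv> vec3 0 0 1"

lemma vec3_nth [simp]: "vec3 a b c $ 1 = a" "vec3 a b c $ 2 = b" "vec3 a b c $ 3 = c"
  by (simp_all add: vec3_def)

lemma cross_nth:
  "(u \<otimes> v) $ 1 = u$2 * v$3 - u$3 * v$2"
  "(u \<otimes> v) $ 2 = u$3 * v$1 - u$1 * v$3"
  "(u \<otimes> v) $ 3 = u$1 * v$2 - u$2 * v$1"
  by (simp_all add: ccross_def)

lemma vec3_eq_iff: "u = v \<longleftrightarrow> u$1 = v$1 \<and> u$2 = v$2 \<and> u$3 = v$3" for u v :: "complex^3"
  by (simp add: vec_eq_iff forall_3)

lemma zorn_cases [cases type]: obtains a u v b where "x = zorn a u v b"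
proof
  show "x = zorn (x$E1) (vec3 (x$U1) (x$U2) (x$U3)) (vec3 (x$V1) (x$V2) (x$V3)) (x$E2)"
    by (simp add: zorn_def oct_eq_iff)
qed

lemma zorn_eq_iff [simp]: "zorn a u v b = zorn a' u' v' b' \<longleftrightarrow> a = a' \<and> u = u' \<and> v = v' \<and> b = b'"
  by (auto simp: zorn_def oct_eq_iff vec3_eq_iff)

lemma zorn_add: "zorn a u v b + zorn a' u' v' b' = zorn (a + a') (u + u') (v + v') (b + b')"
  and zorn_diff: "zorn a u v b - zorn a' u' v' b' = zorn (a - a') (u - u') (v - v') (b - b')"
  and zorn_scale: "c *s zorn a u v b = zorn (c * a) (c *s u) (c *s v) (c * b)"
  and zorn_uminus: "- zorn a u v b = zorn (- a) (- u) (- v) (- b)"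
  and zorn_0: "zorn 0 0 0 0 = 0"
  by (simp_all add: zorn_def oct_eq_iff)

lemma zorn_eq_0_iff [simp]: "zorn a u v b = 0 \<longleftrightarrow> a = 0 \<and> u = 0 \<and> v = 0 \<and> b = 0"
  unfolding zorn_0 [symmetric] zorn_eq_iff ..

lemma zorn_mult:
  "zorn a u v b \<star> zorn a' u' v' b' =
    zorn (a * a' + u \<odot> v') (a *s u' + b' *s u - v \<otimes> v') (a' *s v + b *s v' + u \<otimes> u') (b * b' + v \<odot> u')"
  by (simp add: zorn_def oct_mult_def oct_eq_iff cross_nth dot3_def)

lemma oct_norm_zorn [simp]: "oct_norm (zorn a u v b) = a * b - u \<odot> v"
  by (simp add: zorn_def oct_norm_def dot3_def)

definition oct_trace :: "octonion \<Rightarrow> complex" where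
  "oct_trace x = x$E1 + x$E2"

lemma oct_trace_zorn [simp]: "oct_trace (zorn a u v b) = a + b"
  by (simp add: zorn_def oct_trace_def)

abbreviation oct_one :: octonion where "oct_one \<equiv> zorn 1 0 0 1"

lemmas vec3_simps = vec3_eq_iff cross_nth dot3_def

lemma dot_algebra:
  "u \<odot> (v + w) = u \<odot> v + u \<odot> w" "(v + w) \<odot> u = v \<odot> u + w \<odot> u"
  "u \<odot> (v - w) = u \<odot> v - u \<odot> w" "(v - w) \<odot> u = v \<odot> u - w \<odot> u"
  "u \<odot> (c *s v) = c * (u \<odot> v)" "(c *s v) \<odot> u = c * (v \<odot> u)"
  "u \<odot> (- v) = - (u \<odot> v)" "(- v) \<odot> u = - (v \<odot> u)" "0 \<odot> u = 0" "u \<odot> 0 = 0"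
  by (simp_all add: vec3_simps algebra_simps)

lemma cross_algebra:
  "u \<otimes> (v + w) = u \<otimes> v + u \<otimes> w" "(v + w) \<otimes> u = v \<otimes> u + w \<otimes> u"
  "u \<otimes> (v - w) = u \<otimes> v - u \<otimes> w" "(v - w) \<otimes> u = v \<otimes> u - w \<otimes> u"
  "u \<otimes> (c *s v) = c *s (u \<otimes> v)" "(c *s v) \<otimes> u = c *s (v \<otimes> u)"
  "u \<otimes> (- v) = - (u \<otimes> v)" "(- v) \<otimes> u = - (v \<otimes> u)" "0 \<otimes> u = 0" "u \<otimes> 0 = 0" "u \<otimes> u = 0"
  by (simp_all add: vec3_simps algebra_simps)

lemma cross_basis:
  "e1 \<otimes> e2 = e3" "e2 \<otimes> e3 = e1"
  "e3 \<otimes> e1 = e2" "e2 \<otimes> e1 = - e3"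
  "e3 \<otimes> e2 = - e1" "e1 \<otimes> e3 = - e2"
  by (simp_all add: vec3_simps)

lemma cross_anticommute: "u \<otimes> v = - (v \<otimes> u)"
  by (simp add: vec3_simps)

lemma dot_cross_self: "u \<odot> (u \<otimes> v) = 0" "u \<odot> (v \<otimes> u) = 0" "(u \<otimes> v) \<odot> u = 0" "(v \<otimes> u) \<odot> u = 0"
  by (simp_all add: vec3_simps algebra_simps)

lemma dot_commute: "u \<odot> v = v \<odot> u"
  by (simp add: dot3_def)

lemma exists_dot_eq:
  assumes "v \<noteq> 0" shows "\<exists>w. w \<odot> v = c"
proof -
  consider "v$1 \<noteq> 0" | "v$2 \<noteq> 0" | "v$3 \<noteq> 0" using assms by (auto simp: vec3_eq_iff)
  then show ?thesis
  proof cases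
    case 1 then show ?thesis by (intro exI [of _ "vec3 (c / v$1) 0 0"]) (simp add: dot3_def)
  next
    case 2 then show ?thesis by (intro exI [of _ "vec3 0 (c / v$2) 0"]) (simp add: dot3_def)
  next
    case 3 then show ?thesis by (intro exI [of _ "vec3 0 0 (c / v$3)"]) (simp add: dot3_def)
  qed
qed

text \<open>The vectors orthogonal to \<open>u\<close> are exactly the cross products with \<open>u\<close>. This completes vectors to
matrices with prescribed columns or prescribed cofactors.\<close>

lemma exists_cross_eq:
  assumes "u \<noteq> 0" "u \<odot> v = 0" shows "\<exists>w. w \<otimes> u = v"
proof -
  consider "u$1 \<noteq> 0" | "u$2 \<noteq> 0" | "u$3 \<noteq> 0" using assms by (auto simp: vec3_eq_iff)
  then show ?thesis
  proof cases
    case 1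
    have "u$1 * v$1 = - (u$2 * v$2 + u$3 * v$3)" using assms(2) unfolding dot3_def by algebra
    then have h: "v$1 = - (u$2 * v$2 + u$3 * v$3) / u$1" using 1 by (simp add: nonzero_eq_divide_eq mult.commute)
    then show ?thesis
      by (intro exI [of _ "vec3 0 (- v$3 / u$1) (v$2 / u$1)"]) (simp only: vec3_simps vec3_nth h, simp add: field_simps 1)
  next
    case 2
    have "u$2 * v$2 = - (u$1 * v$1 + u$3 * v$3)" using assms(2) unfolding dot3_def by algebra
    then have h: "v$2 = - (u$1 * v$1 + u$3 * v$3) / u$2" using 2 by (simp add: nonzero_eq_divide_eq mult.commute)
    then show ?thesis
      by (intro exI [of _ "vec3 (v$3 / u$2) 0 (- v$1 / u$2)"]) (simp only: vec3_simps vec3_nth h, simp add: field_simps 2)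
  next
    case 3
    have "u$3 * v$3 = - (u$1 * v$1 + u$2 * v$2)" using assms(2) unfolding dot3_def by algebra
    then have h: "v$3 = - (u$1 * v$1 + u$2 * v$2) / u$3" using 3 by (simp add: nonzero_eq_divide_eq mult.commute)
    then show ?thesis
      by (intro exI [of _ "vec3 (- v$2 / u$3) (v$1 / u$3) 0"]) (simp only: vec3_simps vec3_nth h, simp add: field_simps 3)
  qed
qed

lemma exists_cross_factors:
  assumes "v \<noteq> 0" shows "\<exists>c1 c2. c1 \<otimes> c2 = v"
proof -
  have "\<exists>u. u \<noteq> 0 \<and> u \<odot> v = 0"
  proof (cases "v$1 = 0 \<and> v$2 = 0")
    case True then show ?thesis by (intro exI [of _ "e1"]) (simp add: vec3_simps)
  next
    case False then show ?thesis by (intro exI [of _ "vec3 (v$2) (- v$1) 0"]) (auto simp: vec3_simps)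
  qed
  then show ?thesis using exists_cross_eq by blast
qed

lemma exists_cross_nonzero:
  assumes "u \<noteq> 0" shows "\<exists>y. u \<otimes> y \<noteq> 0"
proof (rule ccontr)
  assume "\<nexists>y. u \<otimes> y \<noteq> 0"
  then have "u \<otimes> e1 = 0" "u \<otimes> e2 = 0" by blast+
  with assms show False by (simp add: vec3_simps)
qed

lemma cross_eq_0_imp_scale:
  assumes "u \<noteq> 0" "u \<otimes> v = 0" shows "\<exists>k. v = k *s u"
proof -
  consider "u$1 \<noteq> 0" | "u$2 \<noteq> 0" | "u$3 \<noteq> 0" using assms by (auto simp: vec3_eq_iff)
  then show ?thesis
  proof cases
    case 1 then show ?thesis using assms by (intro exI [of _ "v$1 / u$1"]) (simp add: vec3_simps field_simps)
  next
    case 2 then show ?thesis using assms by (intro exI [of _ "v$2 / u$2"]) (simp add: vec3_simps field_simps)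
  next
    case 3 then show ?thesis using assms by (intro exI [of _ "v$3 / u$3"]) (simp add: vec3_simps field_simps)
  qed
qed

section \<open>Automorphisms of the octonions\<close>

lemma oct_one_mult [simp]: "oct_one \<star> x = x" "x \<star> oct_one = x"
  by (cases x; simp add: zorn_mult dot_algebra cross_algebra)+

text \<open>Trace and norm are the coefficients of the quadratic equation of an octonion, hence they are
determined by the multiplication.\<close>

lemma oct_square: "x \<star> x = oct_trace x *s x - oct_norm x *s oct_one"
  by (cases x) (simp add: zorn_mult zorn_scale zorn_diff vec3_simps algebra_simps)

definition oct_polar :: "octonion \<Rightarrow> octonion \<Rightarrow> complex" where
  "oct_polar x y = oct_norm (x + y) - oct_norm x - oct_norm y"

lemma oct_polar_zorn [simp]:
  "oct_polar (zorn a u v b) (zorn a' u' v' b') = a * b' + a' * b - u \<odot> v' - u' \<odot> v"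
  by (simp add: oct_polar_def zorn_add dot_algebra algebra_simps)

lemma oct_polar_nondegenerate:
  assumes "\<And>y. oct_polar x y = 0" shows "x = 0"
proof (cases x)
  case (1 a u v b)
  have "oct_polar x (zorn 0 0 0 1) = 0" "oct_polar x (zorn 1 0 0 0) = 0"
    "oct_polar x (zorn 0 e1 0 0) = 0" "oct_polar x (zorn 0 e2 0 0) = 0"
    "oct_polar x (zorn 0 e3 0 0) = 0" "oct_polar x (zorn 0 0 e1 0) = 0"
    "oct_polar x (zorn 0 0 e2 0) = 0" "oct_polar x (zorn 0 0 e3 0) = 0"
    using assms by blast+
  then show ?thesis by (simp add: 1 vec3_simps)
qed

lemma oct_polar_one: "oct_polar x oct_one = oct_trace x"
  by (cases x) (simp add: dot_algebra)

lemma G2_mult: "A \<in> G2 \<Longrightarrow> A *v (x \<star> y) = (A *v x) \<star> (A *v y)"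
  by (simp add: G2_def)

lemma G2_invertible: "A \<in> G2 \<Longrightarrow> invertible A"
  by (simp add: G2_def)

lemma matrix_inv_left: "invertible A \<Longrightarrow> matrix_inv A ** A = mat 1"
  and matrix_inv_right: "invertible A \<Longrightarrow> A ** matrix_inv A = mat 1" for A :: "complex^'n^'n"
proof -
  assume "invertible A"
  then have "A ** matrix_inv A = mat 1 \<and> matrix_inv A ** A = mat 1"
    unfolding invertible_def matrix_inv_def by (rule someI_ex)
  then show "matrix_inv A ** A = mat 1" "A ** matrix_inv A = mat 1" by blast+
qed

lemma matrix_inv_unique: "A ** B = mat 1 \<Longrightarrow> matrix_inv A = B" for A B :: "complex^'n^'n"
  by (metis invertible_def matrix_inv_right matrix_left_right_inverse matrix_mul_assoc matrix_mul_lid matrix_mul_rid)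

lemma G2_inv_vec [simp]:
  "A \<in> G2 \<Longrightarrow> matrix_inv A *v (A *v x) = x" "A \<in> G2 \<Longrightarrow> A *v (matrix_inv A *v x) = x"
  by (simp_all add: matrix_vector_mul_assoc matrix_inv_left matrix_inv_right G2_invertible)

lemma G2_compose: "A \<in> G2 \<Longrightarrow> B \<in> G2 \<Longrightarrow> A ** B \<in> G2"
  by (simp add: G2_def invertible_mult flip: matrix_vector_mul_assoc)

lemma G2_id: "mat 1 \<in> G2"
  by (auto simp: G2_def invertible_def intro: exI [of _ "mat 1"])

lemma G2_inverse:
  assumes "A \<in> G2" shows "matrix_inv A \<in> G2"
proof -
  have "invertible (matrix_inv A)"
    unfolding invertible_def using assms matrix_inv_left matrix_inv_right G2_invertible by blast
  moreover have "matrix_inv A *v (x \<star> y) = (matrix_inv A *v x) \<star> (matrix_inv A *v y)" for x y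
  proof -
    have "A *v ((matrix_inv A *v x) \<star> (matrix_inv A *v y)) = x \<star> y"
      by (simp add: G2_mult assms)
    then show ?thesis by (metis G2_inv_vec(1) assms)
  qed
  ultimately show ?thesis by (simp add: G2_def)
qed

lemma G2_one:
  assumes "A \<in> G2" shows "A *v oct_one = oct_one"
proof -
  have "(A *v oct_one) \<star> oct_one = oct_one"
    using G2_mult [OF assms, of oct_one "matrix_inv A *v oct_one"] assms by simp
  then show ?thesis by simp
qed

text \<open>An automorphism fixes the unit element, so \<open>A *v x\<close> satisfies the quadratic equation of \<open>x\<close>. The
coefficients of such an equation are unique unless the element is a scalar.\<close>

lemma G2_trace_norm:
  assumes "A \<in> G2"
  shows "oct_trace (A *v x) = oct_trace x \<and> oct_norm (A *v x) = oct_norm x"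
proof (cases "\<exists>c. A *v x = c *s oct_one")
  case True
  then obtain c where "A *v x = c *s oct_one" by blast
  then have "x = c *s oct_one"
    using G2_inv_vec(1) [OF assms, of x] G2_one [OF G2_inverse [OF assms]]
    by (simp add: matrix_vector_mult_scaleR vec.scale)
  then show ?thesis using G2_one [OF assms] by (simp add: vec.scale)
next
  case False
  let ?y = "A *v x"
  have "?y \<star> ?y = oct_trace x *s ?y - oct_norm x *s oct_one"
    unfolding G2_mult [OF assms, symmetric] oct_square [of x] vec.diff vec.scale G2_one [OF assms] ..
  then have eq: "(oct_trace x - oct_trace ?y) *s ?y = (oct_norm x - oct_norm ?y) *s oct_one"
    by (simp add: oct_square vec.scale_left_diff_distrib algebra_simps)
  have "oct_trace x - oct_trace ?y = 0"
  proof (rule ccontr)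
    assume nz: "oct_trace x - oct_trace ?y \<noteq> 0"
    then have "?y = (1 / (oct_trace x - oct_trace ?y)) *s ((oct_trace x - oct_trace ?y) *s ?y)"
      unfolding vec.scale_scale using nz by simp
    then show False using False unfolding eq by (metis vec.scale_scale)
  qed
  with eq show ?thesis by (simp add: zorn_scale)
qed

lemma G2_trace: "A \<in> G2 \<Longrightarrow> oct_trace (A *v x) = oct_trace x"
  and G2_norm: "A \<in> G2 \<Longrightarrow> oct_norm (A *v x) = oct_norm x"
  using G2_trace_norm by blast+

lemma G2_polar: "A \<in> G2 \<Longrightarrow> oct_polar (A *v x) (A *v y) = oct_polar x y"
  by (simp add: oct_polar_def G2_norm flip: vec.add)

text \<open>Invertibility is automatic: the norm form is nondegenerate, so a linear map that preserves it is
injective.\<close>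

lemma matrix_in_G2:
  assumes lin: "Vector_Spaces.linear (*s) (*s) f"
    and mult: "\<And>x y. f (x \<star> y) = f x \<star> f y"
    and norm: "\<And>x. oct_norm (f x) = oct_norm x"
  shows "matrix f \<in> G2"
proof -
  interpret f: Vector_Spaces.linear "(*s)" "(*s)" f by fact
  have f: "matrix f *v x = f x" for x
    by (rule matrix_works [OF lin])
  have polar: "oct_polar (f x) (f y) = oct_polar x y" for x y
    by (simp add: oct_polar_def norm flip: f.add)
  have "x = 0" if "f x = 0" for x
  proof (rule oct_polar_nondegenerate)
    show "oct_polar x y = 0" for y
      using polar [of x y] that by (simp add: oct_polar_def oct_norm_def)
  qed
  then have "inj f" by (simp add: f.inj_iff_eq_0)
  moreover have "(*v) (matrix f) = f" by (rule ext) (rule f)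
  ultimately have "inj ((*v) (matrix f))" by simp
  then have "invertible (matrix f)"
    using matrix_left_invertible_injective invertible_left_inverse by blast
  then show ?thesis by (simp add: G2_def f mult)
qed

section \<open>Explicit automorphisms\<close>

definition upper :: "octonion \<Rightarrow> complex^3" where
  "upper x = vec3 (x$U1) (x$U2) (x$U3)"

definition lower :: "octonion \<Rightarrow> complex^3" where
  "lower x = vec3 (x$V1) (x$V2) (x$V3)"

lemma zorn_sel [simp]:
  "zorn a u v b $ E1 = a" "zorn a u v b $ E2 = b" "upper (zorn a u v b) = u" "lower (zorn a u v b) = v"
  by (simp_all add: zorn_def upper_def lower_def vec3_eq_iff)

text \<open>Defines group elements by formulas in the four entries of a vector matrix.\<close>

lemma matrix_zorn:
  fixes f :: "complex \<Rightarrow> complex^3 \<Rightarrow> complex^3 \<Rightarrow> complex \<Rightarrow> octonion"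
  defines "g \<equiv> \<lambda>x. f (x$E1) (upper x) (lower x) (x$E2)"
  assumes add: "\<And>a u v b a' u' v' b'. f (a + a') (u + u') (v + v') (b + b') = f a u v b + f a' u' v' b'"
    and scale: "\<And>c a u v b. f (c * a) (c *s u) (c *s v) (c * b) = c *s f a u v b"
  shows "matrix g *v zorn a u v b = f a u v b"
    and "\<lbrakk>\<And>a u v b a' u' v' b'. g (zorn a u v b \<star> zorn a' u' v' b') = f a u v b \<star> f a' u' v' b';
      \<And>a u v b. oct_norm (f a u v b) = a * b - u \<odot> v\<rbrakk> \<Longrightarrow> matrix g \<in> G2"
proof -
  have g: "g (zorn a u v b) = f a u v b" for a u v b by (simp add: g_def)
  have "g (x + y) = g x + g y" for x y
    by (cases x; cases y) (simp add: g zorn_add add)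
  moreover have "g (c *s x) = c *s g x" for c x
    by (cases x) (simp add: g zorn_scale scale)
  ultimately have lin: "Vector_Spaces.linear (*s) (*s) g"
    unfolding linear_iff_oct by blast
  show "matrix g *v zorn a u v b = f a u v b"
    by (simp add: matrix_works [OF lin] g)
  assume mult: "\<And>a u v b a' u' v' b'. g (zorn a u v b \<star> zorn a' u' v' b') = f a u v b \<star> f a' u' v' b'"
    and norm: "\<And>a u v b. oct_norm (f a u v b) = a * b - u \<odot> v"
  show "matrix g \<in> G2"
  proof (rule matrix_in_G2 [OF lin])
    show "g (x \<star> y) = g x \<star> g y" for x y
      by (cases x; cases y) (simp only: mult g)
    show "oct_norm (g x) = oct_norm x" for x
      by (cases x) (simp only: g norm oct_norm_zorn)
  qed
qed

definition lin3 :: "complex^3 \<Rightarrow> complex^3 \<Rightarrow> complex^3 \<Rightarrow> complex^3 \<Rightarrow> complex^3" where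
  "lin3 c1 c2 c3 u = u$1 *s c1 + u$2 *s c2 + u$3 *s c3"

text \<open>The cofactor matrix. If the determinant is \<open>1\<close>, it is the inverse transpose, by which \<open>SL\<^sub>3\<close> acts on
the lower vector when it acts naturally on the upper one.\<close>

abbreviation cof3 :: "complex^3 \<Rightarrow> complex^3 \<Rightarrow> complex^3 \<Rightarrow> complex^3 \<Rightarrow> complex^3" where
  "cof3 c1 c2 c3 \<equiv> lin3 (c2 \<otimes> c3) (c3 \<otimes> c1) (c1 \<otimes> c2)"

abbreviation det3 :: "complex^3 \<Rightarrow> complex^3 \<Rightarrow> complex^3 \<Rightarrow> complex" where
  "det3 c1 c2 c3 \<equiv> c1 \<odot> (c2 \<otimes> c3)"

lemma lin3_linear:
  "lin3 c1 c2 c3 (u + v) = lin3 c1 c2 c3 u + lin3 c1 c2 c3 v"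
  "lin3 c1 c2 c3 (u - v) = lin3 c1 c2 c3 u - lin3 c1 c2 c3 v"
  "lin3 c1 c2 c3 (k *s u) = k *s lin3 c1 c2 c3 u"
  "lin3 c1 c2 c3 (- u) = - lin3 c1 c2 c3 u"
  "lin3 c1 c2 c3 0 = 0"
  by (simp_all add: lin3_def vec3_eq_iff algebra_simps)

lemma lin3_dot_cof3: "lin3 c1 c2 c3 u \<odot> cof3 c1 c2 c3 v = det3 c1 c2 c3 * (u \<odot> v)"
  by (simp add: lin3_def vec3_simps algebra_simps)

lemma cof3_dot_lin3: "cof3 c1 c2 c3 v \<odot> lin3 c1 c2 c3 u = det3 c1 c2 c3 * (v \<odot> u)"
  using lin3_dot_cof3 by (simp only: dot_commute)

lemma lin3_cross: "lin3 c1 c2 c3 u \<otimes> lin3 c1 c2 c3 v = cof3 c1 c2 c3 (u \<otimes> v)"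
  by (simp add: lin3_def vec3_simps algebra_simps)

lemma cross_cross_cyclic:
  "(c3 \<otimes> c1) \<otimes> (c1 \<otimes> c2) = det3 c1 c2 c3 *s c1"
  by (simp add: vec3_simps algebra_simps)

lemma det3_rotate: "det3 c2 c3 c1 = det3 c1 c2 c3" "det3 c3 c1 c2 = det3 c1 c2 c3"
  by (simp_all add: vec3_simps algebra_simps)

lemma cof3_cross: "cof3 c1 c2 c3 u \<otimes> cof3 c1 c2 c3 v = det3 c1 c2 c3 *s lin3 c1 c2 c3 (u \<otimes> v)"
  unfolding lin3_cross cross_cross_cyclic det3_rotate by (simp add: lin3_def vec3_eq_iff algebra_simps)

text \<open>For \<open>w = z e\<^sub>i\<close> these are the elements of the root group of the short root \<open>\<epsilon>\<^sub>i\<close>, written as exponentials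
of derivations; \<open>v_elt\<close> gives the roots \<open>- \<epsilon>\<^sub>i\<close>, and the elementary matrices in \<open>sl3_elt\<close> give the long roots.
The element \<open>swap_elt\<close> acts on the torus by inversion.\<close>

definition u_elt :: "complex^3 \<Rightarrow> oct_matrix" where
  "u_elt w = matrix (\<lambda>x. zorn (x$E1 + w \<odot> lower x)
     (upper x - (x$E1 - x$E2) *s w - (w \<odot> lower x) *s w) (lower x + upper x \<otimes> w) (x$E2 - w \<odot> lower x))"

definition swap_elt :: oct_matrix where
  "swap_elt = matrix (\<lambda>x. zorn (x$E2) (- lower x) (- upper x) (x$E1))"

definition sl3_elt :: "complex^3 \<Rightarrow> complex^3 \<Rightarrow> complex^3 \<Rightarrow> oct_matrix" where
  "sl3_elt c1 c2 c3 = matrix (\<lambda>x. zorn (x$E1) (lin3 c1 c2 c3 (upper x)) (cof3 c1 c2 c3 (lower x)) (x$E2))"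

definition v_elt :: "complex^3 \<Rightarrow> oct_matrix" where
  "v_elt w = swap_elt ** u_elt w ** swap_elt"

lemma u_elt_zorn:
  "u_elt w *v zorn a u v b = zorn (a + w \<odot> v) (u - (a - b) *s w - (w \<odot> v) *s w) (v + u \<otimes> w) (b - w \<odot> v)"
  unfolding u_elt_def
  by (rule matrix_zorn) (simp_all add: zorn_add zorn_scale vec3_simps algebra_simps)

lemma u_elt_in_G2: "u_elt w \<in> G2"
  unfolding u_elt_def
  by (rule matrix_zorn; simp add: zorn_add zorn_scale zorn_mult vec3_simps algebra_simps)

lemma swap_elt_zorn: "swap_elt *v zorn a u v b = zorn b (- v) (- u) a"
  unfolding swap_elt_def
  by (rule matrix_zorn) (simp_all add: zorn_add zorn_scale vec3_simps algebra_simps)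

lemma swap_elt_in_G2: "swap_elt \<in> G2"
  unfolding swap_elt_def
  by (rule matrix_zorn; simp add: zorn_add zorn_scale zorn_mult vec3_simps algebra_simps)

lemma sl3_elt_zorn: "sl3_elt c1 c2 c3 *v zorn a u v b = zorn a (lin3 c1 c2 c3 u) (cof3 c1 c2 c3 v) b"
  unfolding sl3_elt_def
  by (rule matrix_zorn) (simp_all add: zorn_add zorn_scale lin3_linear)

lemma sl3_elt_in_G2:
  assumes "det3 c1 c2 c3 = 1" shows "sl3_elt c1 c2 c3 \<in> G2"
  unfolding sl3_elt_def
  by (rule matrix_zorn; simp add: zorn_add zorn_scale zorn_mult lin3_linear lin3_cross [of c1 c2 c3] cof3_cross
      lin3_dot_cof3 cof3_dot_lin3 assms)

lemma v_elt_zorn: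
  "v_elt w *v zorn a u v b = zorn (a + w \<odot> u) (u + v \<otimes> w) (v + (b - a) *s w - (w \<odot> u) *s w) (b - w \<odot> u)"
  unfolding v_elt_def matrix_vector_mul_assoc [symmetric] swap_elt_zorn u_elt_zorn
  by (simp add: vec3_simps algebra_simps)

lemma v_elt_in_G2: "v_elt w \<in> G2"
  by (simp add: v_elt_def G2_compose swap_elt_in_G2 u_elt_in_G2)

lemma oct_matrix_eqI:
  assumes "\<And>a u v b. A *v zorn a u v b = B *v zorn a u v b" shows "A = B"
  unfolding matrix_eq by (metis assms zorn_cases)

lemma torus_elt_zorn:
  "torus_elt t1 t2 t3 *v zorn a u v b =
    zorn a (vec3 (t1 * u$1) (t2 * u$2) (t3 * u$3)) (vec3 (v$1 / t1) (v$2 / t2) (v$3 / t3)) b"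
  by (simp add: torus_elt_works zorn_def)

section \<open>Two transitive actions\<close>

abbreviation idem :: octonion where "idem \<equiv> zorn 1 0 0 0"

abbreviation hwv :: octonion where "hwv \<equiv> zorn 0 0 e3 0"

lemma exists_sl3_cross:
  assumes "v \<noteq> 0" obtains c1 c2 c3 where "det3 c1 c2 c3 = 1" "c1 \<otimes> c2 = v"
proof -
  obtain c1 c2 where c: "c1 \<otimes> c2 = v" using exists_cross_factors [OF assms] by blast
  obtain c3 where "c3 \<odot> v = 1" using exists_dot_eq [OF assms] by blast
  then have "det3 c1 c2 c3 = 1" using c by (metis det3_rotate(2))
  with c that show ?thesis by blast
qed

text \<open>The octonions of trace \<open>1\<close> and norm \<open>0\<close> are the nontrivial idempotents. Short root elements clear the
entries of \<open>e\<close> one after another; they need a nonzero lower vector to start with, which \<open>swap_elt\<close>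
provides if the upper vector is nonzero.\<close>

lemma G2_transitive_idempotents:
  assumes "oct_trace e = 1" "oct_norm e = 0"
  obtains g where "g \<in> G2" "g *v idem = e"
proof -
  have main: "\<exists>g\<in>G2. g *v e = idem" if "oct_trace e = 1" "oct_norm e = 0" "lower e \<noteq> 0" for e
  proof (cases e)
    case (1 a u v b)
    with that have v: "v \<noteq> 0" and ab: "a + b = 1" "a * b = u \<odot> v" by simp_all
    obtain w where w: "w \<odot> v = 1 - a" using exists_dot_eq [OF v] by blast
    \<comment> \<open>The element \<open>u_elt w\<close> makes the diagonal entries \<open>1\<close> and \<open>0\<close>, then \<open>u_elt\<close> and \<open>v_elt\<close> clear \<open>u\<close> and \<open>v\<close>.\<close>
    define u' v' where "u' = u - (a - b) *s w - (w \<odot> v) *s w" and "v' = v + u \<otimes> w"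
    have "b = 1 - a" using ab by (simp add: algebra_simps)
    then have ue: "u_elt w *v e = zorn 1 u' v' 0"
      using w by (simp add: 1 u_elt_zorn u'_def v'_def)
    have "oct_norm (u_elt w *v e) = 0" using G2_norm [OF u_elt_in_G2] that by simp
    then have u'v': "u' \<odot> v' = 0" by (simp add: ue)
    have "u_elt u' *v (u_elt w *v e) = zorn 1 0 v' 0"
      by (simp add: ue u_elt_zorn u'v' cross_algebra)
    moreover have "v_elt v' *v (zorn 1 0 v' 0) = idem"
      by (simp add: v_elt_zorn cross_algebra dot_algebra)
    ultimately have "(v_elt v' ** u_elt u' ** u_elt w) *v e = idem"
      by (simp flip: matrix_vector_mul_assoc)
    then show ?thesis using G2_compose u_elt_in_G2 v_elt_in_G2 by blast
  qed
  have "\<exists>g\<in>G2. g *v e = idem"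
  proof (cases "lower e = 0")
    case False then show ?thesis using main assms by blast
  next
    case lower: True
    show ?thesis
    proof (cases "upper e = 0")
      case False
      let ?e = "swap_elt *v e"
      have "lower ?e \<noteq> 0" using False by (cases e) (simp add: swap_elt_zorn)
      moreover have "oct_trace ?e = 1" "oct_norm ?e = 0"
        using assms by (simp_all add: G2_trace G2_norm swap_elt_in_G2)
      ultimately obtain g where "g \<in> G2" "g *v ?e = idem" using main by blast
      then have "g ** swap_elt \<in> G2" "(g ** swap_elt) *v e = idem"
        using G2_compose swap_elt_in_G2 by (simp_all flip: matrix_vector_mul_assoc)
      then show ?thesis by blast
    next
      case True
      then obtain a b where e: "e = zorn a 0 0 b" using lower by (cases e) simp
      with assms have ab: "a + b = 1" "a * b = 0" by (simp_all add: dot_algebra)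
      then consider "a = 1" "b = 0" | "a = 0" "b = 1" by auto
      then show ?thesis
      proof cases
        case 1 then show ?thesis using e G2_id by (intro bexI [of _ "mat 1"]) simp_all
      next
        case 2 then show ?thesis
          using e swap_elt_in_G2 by (intro bexI [of _ swap_elt]) (simp_all add: swap_elt_zorn)
      qed
    qed
  qed
  then obtain g where "g \<in> G2" "g *v e = idem" by blast
  then have "matrix_inv g \<in> G2" "matrix_inv g *v idem = e"
    using G2_inverse G2_inv_vec(1) by (blast, metis)
  then show ?thesis using that by blast
qed

text \<open>The nonzero null vectors of trace zero are the cone over the 5-dimensional quadric of \<open>G\<^sub>2\<close>. Again a
short root element clears the diagonal, and \<open>SL\<^sub>3\<close> together with one more short root element reaches
every remaining vector.\<close>

lemma G2_transitive_null:
  assumes "oct_trace x = 0" "oct_norm x = 0" "x \<noteq> 0"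
  obtains g where "g \<in> G2" "g *v hwv = x"
proof -
  have nul: "\<exists>g\<in>G2. g *v hwv = zorn 0 u v 0" if v: "v \<noteq> 0" and uv: "u \<odot> v = 0" for u v
  proof -
    obtain c1 c2 c3 where c: "det3 c1 c2 c3 = 1" "c1 \<otimes> c2 = v" using exists_sl3_cross [OF v] by blast
    let ?s = "sl3_elt c1 c2 c3"
    have s: "?s \<in> G2" using sl3_elt_in_G2 c by blast
    have sv: "?s *v hwv = zorn 0 0 v 0"
      using c by (simp add: sl3_elt_zorn lin3_linear lin3_def)
    obtain w where w: "w \<otimes> v = - u" using exists_cross_eq [OF v, of "- u"] uv by (auto simp: dot_algebra dot_commute)
    have "v_elt w *v zorn 0 0 v 0 = zorn 0 (- (w \<otimes> v)) v 0"
      by (simp add: v_elt_zorn dot_algebra) (simp add: vec3_simps)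
    with sv w have "(v_elt w ** ?s) *v hwv = zorn 0 u v 0"
      by (simp flip: matrix_vector_mul_assoc)
    then show ?thesis using G2_compose v_elt_in_G2 s by blast
  qed
  have trans: "\<exists>g\<in>G2. g *v hwv = x" if "\<exists>g\<in>G2. g *v hwv = A *v x" "A \<in> G2" for A x
  proof -
    from that obtain g where g: "g \<in> G2" "g *v hwv = A *v x" by blast
    then have "(matrix_inv A ** g) *v hwv = x" using that by (simp flip: matrix_vector_mul_assoc)
    then show ?thesis using G2_compose G2_inverse g that by blast
  qed
  obtain a u v b where "x = zorn a u v b" by (rule zorn_cases)
  with assms have x: "x = zorn a u v (- a)" and uv: "u \<odot> v = - (a * a)"
    by (simp_all add: add_eq_0_iff)
  have "\<exists>g\<in>G2. g *v hwv = x"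
  proof (cases "v = 0")
    case False
    obtain w where w: "w \<odot> v = - a" using exists_dot_eq [OF False] by blast
    obtain u' v' where x': "u_elt w *v x = zorn 0 u' v' 0"
      using w by (simp add: x u_elt_zorn)
    have *: "\<exists>g\<in>G2. g *v hwv = zorn 0 u' v' 0"
    proof (cases "v' = 0")
      case True
      have u'0: "u' \<noteq> 0"
        using x' True assms by (metis G2_inv_vec(1) u_elt_in_G2 zorn_0 vec.zero)
      have "\<exists>g\<in>G2. g *v hwv = swap_elt *v zorn 0 u' v' 0"
        using nul [of "- u'" 0] u'0 by (simp add: True swap_elt_zorn dot_algebra)
      then show ?thesis using trans swap_elt_in_G2 by blast
    next
      case False
      have "oct_norm (u_elt w *v x) = 0" using G2_norm [OF u_elt_in_G2] assms by simp
      then show ?thesis using nul [OF False] by (simp add: x')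
    qed
    then show ?thesis unfolding x' [symmetric] using trans u_elt_in_G2 by blast
  next
    case True
    then have "a = 0" "u \<noteq> 0" using uv x assms by (auto simp: dot_algebra)
    then have "\<exists>g\<in>G2. g *v hwv = swap_elt *v x"
      using nul [of "- u" 0] True by (simp add: x swap_elt_zorn dot_algebra)
    then show ?thesis using trans swap_elt_in_G2 by blast
  qed
  then show ?thesis using that by blast
qed

text \<open>Such an automorphism preserves the Peirce spaces of the idempotent, that is, the upper and the lower
vectors. Lower vectors are products of upper ones, so \<open>g\<close> is known from its columns on the upper
vectors, and \<open>U1 \<star> V1 = E1\<close> says that they have determinant \<open>1\<close>.\<close>

lemma G2_fixing_idem_is_sl3:
  assumes g: "g \<in> G2" and e: "g *v idem = idem"
  obtains c1 c2 c3 where "det3 c1 c2 c3 = 1" "g = sl3_elt c1 c2 c3"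
proof -
  have one: "g *v zorn 0 0 0 1 = zorn 0 0 0 1"
  proof -
    have "zorn 0 0 0 1 = oct_one - idem" by (simp add: zorn_diff)
    then show ?thesis using G2_one [OF g] e by (simp add: vec.diff)
  qed
  have up: "\<exists>c. g *v zorn 0 u 0 0 = zorn 0 c 0 0" for u
  proof -
    have "idem \<star> (g *v zorn 0 u 0 0) = g *v zorn 0 u 0 0" "(g *v zorn 0 u 0 0) \<star> idem = 0"
      using G2_mult [OF g, of idem "zorn 0 u 0 0"] G2_mult [OF g, of "zorn 0 u 0 0" idem] e
      by (simp_all add: zorn_mult dot_algebra cross_algebra zorn_0)
    then show ?thesis by (cases "g *v zorn 0 u 0 0") (auto simp: zorn_mult dot_algebra cross_algebra)
  qed
  obtain c1 c2 c3 where c: "g *v zorn 0 e1 0 0 = zorn 0 c1 0 0"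
    "g *v zorn 0 e2 0 0 = zorn 0 c2 0 0" "g *v zorn 0 e3 0 0 = zorn 0 c3 0 0"
    using up by metis
  have v: "g *v zorn 0 0 e1 0 = zorn 0 0 (c2 \<otimes> c3) 0"
    "g *v zorn 0 0 e2 0 = zorn 0 0 (c3 \<otimes> c1) 0"
    "g *v zorn 0 0 e3 0 = zorn 0 0 (c1 \<otimes> c2) 0"
    using G2_mult [OF g, of "zorn 0 e2 0 0" "zorn 0 e3 0 0"]
      G2_mult [OF g, of "zorn 0 e3 0 0" "zorn 0 e1 0 0"]
      G2_mult [OF g, of "zorn 0 e1 0 0" "zorn 0 e2 0 0"]
    by (simp_all add: c zorn_mult dot_algebra cross_algebra cross_basis)
  have "zorn (det3 c1 c2 c3) 0 0 0 = idem"
    using G2_mult [OF g, of "zorn 0 e1 0 0" "zorn 0 0 e1 0"]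
    by (simp add: c v zorn_mult dot_algebra cross_algebra) (simp add: dot3_def e)
  then have "det3 c1 c2 c3 = 1" by simp
  moreover have "g = sl3_elt c1 c2 c3"
  proof (rule oct_matrix_eqI)
    fix a u v' b
    have "zorn a u v' b = a *s idem + b *s zorn 0 0 0 1 + u$1 *s zorn 0 e1 0 0
      + u$2 *s zorn 0 e2 0 0 + u$3 *s zorn 0 e3 0 0 + v'$1 *s zorn 0 0 e1 0
      + v'$2 *s zorn 0 0 e2 0 + v'$3 *s zorn 0 0 e3 0"
      by (simp add: zorn_add zorn_scale vec3_eq_iff)
    then have "g *v zorn a u v' b = a *s idem + b *s zorn 0 0 0 1 + u$1 *s zorn 0 c1 0 0
      + u$2 *s zorn 0 c2 0 0 + u$3 *s zorn 0 c3 0 0 + v'$1 *s zorn 0 0 (c2 \<otimes> c3) 0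
      + v'$2 *s zorn 0 0 (c3 \<otimes> c1) 0 + v'$3 *s zorn 0 0 (c1 \<otimes> c2) 0"
      by (simp only: vec.add vec.scale e one c v)
    then show "g *v zorn a u v' b = sl3_elt c1 c2 c3 *v zorn a u v' b"
      by (simp add: zorn_add zorn_scale sl3_elt_zorn lin3_def)
  qed
  ultimately show ?thesis using that by blast
qed

section \<open>Conjugating semisimple elements into the torus\<close>

text \<open>The eigenvectors span, so every proper subspace misses one of them. With kernels of suitable linear
maps as \<open>W\<close>, this replaces choosing subsets of an eigenbasis.\<close>

lemma semisimple_eigenvector_outside:
  fixes s :: "complex^'n^'n"
  assumes s: "semisimple_elt s" and W: "vec.subspace W" "W \<noteq> UNIV"
  obtains p d where "s *v p = d *s p" "p \<notin> W"
proof -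
  obtain P D :: "complex^'n^'n" where PD: "invertible P" "diagonal_matrix D" "s = P ** D ** matrix_inv P"
    using s unfolding semisimple_elt_def by blast
  have "\<exists>i. column i P \<notin> W"
  proof (rule ccontr)
    assume *: "\<nexists>i. column i P \<notin> W"
    have "x \<in> W" for x
    proof -
      have "x = P *v (matrix_inv P *v x)"
        by (simp add: matrix_vector_mul_assoc matrix_inv_right PD)
      also have "\<dots> \<in> W"
        unfolding matrix_mult_sum by (rule vec.subspace_sum [OF W(1)]) (use * vec.subspace_scale [OF W(1)] in blast)
      finally show ?thesis .
    qed
    with W show False by blast
  qed
  then obtain i where i: "column i P \<notin> W" by blast
  have ax: "A *v axis i 1 = column i A" for A :: "complex^'n^'n"
    by (simp add: vec_eq_iff matrix_vector_mult_def column_def axis_def if_distrib [of "(*) _"] cong: if_cong)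
  note col = ax [of P, symmetric]
  have D: "D *v axis i 1 = (D $ i $ i) *s axis i 1"
    unfolding ax using PD(2) by (auto simp: vec_eq_iff column_def axis_def diagonal_matrix_def)
  have "s *v column i P = P *v (D *v ((matrix_inv P ** P) *v axis i 1))"
    by (simp add: col PD(3) matrix_vector_mul_assoc matrix_mul_assoc)
  also have "\<dots> = (D $ i $ i) *s column i P"
    by (simp add: matrix_inv_left PD D vec.scale col)
  finally show ?thesis using i that by blast
qed

lemma oct_trace_linear:
  "oct_trace (x + y) = oct_trace x + oct_trace y" "oct_trace (c *s x) = c * oct_trace x"
  by (simp_all add: oct_trace_def algebra_simps)

lemma oct_norm_scale: "oct_norm (c *s x) = c^2 * oct_norm x"
  by (simp add: oct_norm_def power2_eq_square algebra_simps)

lemma oct_polar_linear: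
  "oct_polar x (y + z) = oct_polar x y + oct_polar x z" "oct_polar x (c *s y) = c * oct_polar x y"
  "oct_polar (y + z) x = oct_polar y x + oct_polar z x" "oct_polar (c *s y) x = c * oct_polar y x"
  by (cases x; cases y; cases z; simp add: zorn_add zorn_scale dot_algebra algebra_simps)+

lemma oct_trace_mult: "oct_trace (x \<star> y) = oct_trace x * oct_trace y - oct_polar x y"
  by (cases x; cases y; simp add: zorn_mult vec3_simps algebra_simps)

lemma oct_mult_scale: "(c *s x) \<star> (d *s y) = (c * d) *s (x \<star> y)"
  by (cases x; cases y; simp add: zorn_mult zorn_scale vec3_simps algebra_simps)

text \<open>Otherwise all averages \<open>y + s y\<close> are isotropic. By polarisation they are then orthogonal to everything, so
\<open>s = -1\<close> on octonions of trace zero. This contradicts \<open>U1 \<star> U2 = V3\<close>.\<close>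

lemma involution_fixes_nonisotropic:
  assumes s: "s \<in> G2" and inv: "\<And>x. s *v (s *v x) = x"
  shows "\<exists>y. s *v y = y \<and> oct_trace y = 0 \<and> oct_norm y \<noteq> 0"
proof (rule ccontr)
  assume "\<not> ?thesis"
  then have null: "oct_norm y = 0" if "s *v y = y" "oct_trace y = 0" for y using that by blast
  have avg: "oct_norm (y + s *v y) = 0" if "oct_trace y = 0" for y
    using that by (intro null) (simp_all add: vec.add inv add.commute oct_trace_linear G2_trace [OF s])
  have neg: "y + s *v y = 0" if y: "oct_trace y = 0" for y
  proof (rule oct_polar_nondegenerate)
    let ?y = "y + s *v y"
    have *: "oct_polar ?y z = 0" if z: "oct_trace z = 0" for z
    proof -
      have "0 = oct_polar ?y (z + s *v z)"
        using avg [of "y + z"] avg [OF y] avg [OF z] y z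
        by (simp add: oct_polar_def oct_trace_linear vec.add add_ac)
      also have "oct_polar ?y (s *v z) = oct_polar ?y z"
        using G2_polar [OF s, of ?y z] by (simp add: vec.add inv add.commute)
      then have "oct_polar ?y (z + s *v z) = 2 * oct_polar ?y z"
        by (simp add: oct_polar_linear)
      finally show ?thesis by simp
    qed
    fix z
    let ?c = "oct_trace z / 2"
    have "oct_trace (z + (- ?c) *s oct_one) = 0"
      unfolding oct_trace_linear oct_trace_zorn by simp
    then have "oct_polar ?y (z + (- ?c) *s oct_one) = 0" by (rule *)
    then have "oct_polar ?y z + (- ?c) * oct_polar ?y oct_one = 0"
      unfolding oct_polar_linear(1,2) .
    moreover have "oct_polar ?y oct_one = 0"
      unfolding oct_polar_one oct_trace_linear G2_trace [OF s] y by simp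
    ultimately show "oct_polar ?y z = 0" by simp
  qed
  let ?u1 = "zorn 0 e1 0 0" and ?u2 = "zorn 0 e2 0 0"
  have h: "hwv = ?u1 \<star> ?u2" by (simp add: zorn_mult dot_algebra cross_algebra cross_basis)
  have n: "s *v x = - x" if "oct_trace x = 0" for x
    using neg [OF that] by (metis add_eq_0_iff)
  have "s *v hwv = (- ?u1) \<star> (- ?u2)"
    by (simp only: h G2_mult [OF s]) (simp add: n)
  also have "\<dots> = hwv" by (simp add: zorn_uminus zorn_mult dot_algebra cross_algebra cross_basis)
  finally have "- hwv = hwv" by (simp add: n)
  then show False by (simp add: zorn_uminus vec3_eq_iff)
qed

text \<open>If \<open>s\<close> has an eigenvalue \<open>d\<close> with \<open>d\<^sup>2 \<noteq> 1\<close>, its eigenvector \<open>x\<close> is isotropic and some eigenvector \<open>y\<close>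
for \<open>1 / d\<close> is not orthogonal to it. The product \<open>x \<star> y\<close> is then fixed by \<open>s\<close>, of norm \<open>0\<close> and nonzero
trace. If there is no such eigenvalue, \<open>s\<close> is an involution, and a fixed \<open>y\<close> of trace \<open>0\<close> with
\<open>r\<^sup>2 = - oct_norm y \<noteq> 0\<close> gives the idempotent \<open>(1 + y / r) / 2\<close>.\<close>

lemma semisimple_fixes_idempotent:
  assumes s: "s \<in> G2" "semisimple_elt s"
  obtains e where "s *v e = e" "oct_trace e = 1" "oct_norm e = 0"
proof (cases "\<forall>x. s *v (s *v x) = x")
  case True
  then obtain y where y: "s *v y = y" "oct_trace y = 0" "oct_norm y \<noteq> 0"
    using involution_fixes_nonisotropic [OF s(1)] by blast
  define r where "r = csqrt (- oct_norm y)"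
  have r: "r^2 = - oct_norm y" "r \<noteq> 0" using y by (simp_all add: r_def)
  define e where "e = (1/2) *s (oct_one + (1 / r) *s y)"
  show ?thesis
  proof
    show "s *v e = e" by (simp only: e_def vec.scale vec.add G2_one [OF s(1)] y)
    show "oct_trace e = 1"
      unfolding e_def oct_trace_linear y by simp
    have "oct_norm (oct_one + (1 / r) *s y) =
        oct_polar ((1 / r) *s y) oct_one + oct_norm oct_one + oct_norm ((1 / r) *s y)"
      by (simp add: oct_polar_def add.commute)
    also have "\<dots> = 1 + oct_norm y / r^2"
      unfolding oct_polar_one oct_trace_linear oct_norm_scale y(2) by (simp add: dot_algebra power_divide)
    also have "\<dots> = 0" using y r by simp
    finally show "oct_norm e = 0" unfolding e_def oct_norm_scale by simp
  qed
next
  case False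
  have "vec.subspace {x. s *v (s *v x) = x}"
    by (simp add: vec.subspace_def vec.add vec.scale)
  then obtain x d where x: "s *v x = d *s x" "s *v (s *v x) \<noteq> x"
    using semisimple_eigenvector_outside [OF s(2)] False by blast
  then have "d^2 *s x \<noteq> x" by (simp add: vec.scale power2_eq_square)
  then have d: "d^2 \<noteq> 1" "x \<noteq> 0" by auto
  have tr: "oct_trace z = 0" if "s *v z = c *s z" "c \<noteq> 1" for z c
    using G2_trace [OF s(1), of z] that by (simp add: oct_trace_linear)
  have "oct_norm x = 0" using G2_norm [OF s(1), of x] d by (simp add: x oct_norm_scale)
  \<comment> \<open>Since \<open>x \<noteq> 0\<close>, some eigenvector \<open>y\<close> lies outside its orthogonal complement.\<close>
  have "vec.subspace {y. oct_polar x y = 0}"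
    by (simp add: vec.subspace_def oct_polar_linear) (simp add: oct_polar_def oct_norm_def)
  moreover have "{y. oct_polar x y = 0} \<noteq> UNIV" using oct_polar_nondegenerate [of x] d(2) by blast
  ultimately obtain y c where y: "s *v y = c *s y" "oct_polar x y \<noteq> 0"
    using semisimple_eigenvector_outside [OF s(2)] by blast
  have dc: "d * c = 1" using G2_polar [OF s(1), of x y] y(2) by (simp add: x y oct_polar_linear mult.commute)
  have "d \<noteq> 1" "c \<noteq> 1" using d dc by auto
  then have 0: "oct_trace x = 0" "oct_trace y = 0" using tr x y by blast+
  define e where "e = (- 1 / oct_polar x y) *s (x \<star> y)"
  show ?thesis
  proof
    have "s *v (x \<star> y) = x \<star> y"
      by (simp add: G2_mult s x y oct_mult_scale dc)
    then show "s *v e = e" by (simp only: e_def vec.scale)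
    show "oct_trace e = 1" using y(2) unfolding e_def oct_trace_linear oct_trace_mult 0 by simp
    show "oct_norm e = 0" unfolding e_def oct_norm_scale oct_norm_mult \<open>oct_norm x = 0\<close> by simp
  qed
qed

lemma semisimple_conjugate:
  fixes s g :: "complex^'n^'n"
  assumes "semisimple_elt s" "invertible g" shows "semisimple_elt (matrix_inv g ** s ** g)"
proof -
  obtain P D :: "complex^'n^'n" where PD: "invertible P" "diagonal_matrix D" "s = P ** D ** matrix_inv P"
    using assms unfolding semisimple_elt_def by blast
  have inv: "invertible (matrix_inv g ** P)"
    using assms PD by (metis invertible_def invertible_mult matrix_inv_left matrix_inv_right)
  have "matrix_inv (matrix_inv g ** P) = matrix_inv P ** g"
  proof (rule matrix_inv_unique)
    have "matrix_inv g ** P ** (matrix_inv P ** g) = matrix_inv g ** (P ** matrix_inv P) ** g"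
      by (simp add: matrix_mul_assoc)
    then show "matrix_inv g ** P ** (matrix_inv P ** g) = mat 1"
      by (simp add: matrix_inv_right matrix_inv_left PD assms)
  qed
  then have "matrix_inv g ** s ** g = (matrix_inv g ** P) ** D ** matrix_inv (matrix_inv g ** P)"
    by (simp add: PD matrix_mul_assoc)
  then show ?thesis using inv PD by (auto simp: semisimple_elt_def)
qed

text \<open>Three eigenvectors in the space of upper vectors, rescaled to determinant \<open>1\<close>, are the columns of the
conjugating matrix.\<close>

lemma semisimple_sl3_conj_torus:
  assumes det: "det3 c1 c2 c3 = 1" and ss: "semisimple_elt (sl3_elt c1 c2 c3)"
  obtains h t1 t2 t3 where "h \<in> G2" "t1 * t2 * t3 = 1" "sl3_elt c1 c2 c3 ** h = h ** torus_elt t1 t2 t3"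
proof -
  let ?s = "sl3_elt c1 c2 c3"
  have eig: "\<exists>d u. lin3 c1 c2 c3 u = d *s u \<and> f u \<noteq> 0"
    if lin: "\<And>u v. f (u + v) = f u + f v" "\<And>k u. f (k *s u) = k *s f u" and "f u0 \<noteq> 0"
    for f :: "complex^3 \<Rightarrow> complex^'k" and u0
  proof -
    have up: "upper (x + y) = upper x + upper y" "upper (k *s x) = k *s upper x" for x y k
      by (cases x; cases y; simp add: zorn_add zorn_scale)+
    have "vec.subspace {x. f (upper x) = 0}"
      unfolding vec.subspace_def mem_Collect_eq up lin using lin(2) [of 0 0] up(2) [of 0 0] by simp
    moreover have "{x. f (upper x) = 0} \<noteq> UNIV" 
    proof
      assume "{x. f (upper x) = 0} = UNIV"
      then have "zorn 0 u0 0 0 \<in> {x. f (upper x) = 0}" by blast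
      then show False using \<open>f u0 \<noteq> 0\<close> by simp
    qed
    ultimately obtain p d where p: "?s *v p = d *s p" "f (upper p) \<noteq> 0"
      using semisimple_eigenvector_outside [OF ss] by blast
    from p(1) have "lin3 c1 c2 c3 (upper p) = d *s upper p"
      by (cases p) (simp add: sl3_elt_zorn zorn_scale)
    with p show ?thesis by blast
  qed
  obtain d1 u1 where u1: "lin3 c1 c2 c3 u1 = d1 *s u1" "u1 \<noteq> 0"
    using eig [of "\<lambda>u. u" "e1"] by (auto simp: vec3_eq_iff)
  obtain y where "u1 \<otimes> y \<noteq> 0" using exists_cross_nonzero [OF u1(2)] by blast
  then obtain d2 u2 where u2: "lin3 c1 c2 c3 u2 = d2 *s u2" "u1 \<otimes> u2 \<noteq> 0"
    using eig [of "\<lambda>u. u1 \<otimes> u" y] by (auto simp: cross_algebra)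
  obtain w where w: "w \<odot> (u1 \<otimes> u2) = 1" using exists_dot_eq [OF u2(2)] by blast
  then obtain d3 u where u: "lin3 c1 c2 c3 u = d3 *s u" "u \<odot> (u1 \<otimes> u2) \<noteq> 0"
    using eig [of "\<lambda>u. (vec (u \<odot> (u1 \<otimes> u2)) :: complex^1)" w] by (auto simp: dot_algebra vec_eq_iff)
  define u3 where "u3 = (1 / (u \<odot> (u1 \<otimes> u2))) *s u"
  have u3: "lin3 c1 c2 c3 u3 = d3 *s u3" by (simp add: u3_def lin3_linear u)
  have "u3 \<odot> (u1 \<otimes> u2) = 1" using u(2) by (simp add: u3_def dot_algebra)
  then have detu: "det3 u1 u2 u3 = 1" by (simp only: det3_rotate)
  have cof: "cof3 c1 c2 c3 (u1 \<otimes> u2) = (d1 * d2) *s (u1 \<otimes> u2)"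
    "cof3 c1 c2 c3 (u2 \<otimes> u3) = (d2 * d3) *s (u2 \<otimes> u3)"
    "cof3 c1 c2 c3 (u3 \<otimes> u1) = (d3 * d1) *s (u3 \<otimes> u1)"
    unfolding lin3_cross [symmetric] u1 u2 u3 by (simp_all add: cross_algebra)
  have "d1 * d2 * d3 = lin3 c1 c2 c3 u1 \<odot> cof3 c1 c2 c3 (u2 \<otimes> u3)"
    unfolding cof u1 by (simp add: dot_algebra detu)
  also have "\<dots> = 1" by (simp add: lin3_dot_cof3 det detu)
  finally have d: "d1 * d2 * d3 = 1" .
  then have "d1 * d2 = 1 / d3" "d2 * d3 = 1 / d1" "d3 * d1 = 1 / d2"
    by (metis mult.assoc mult.commute nonzero_eq_divide_eq mult_zero_left zero_neq_one)+
  note cof = cof [unfolded this]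
  show ?thesis
  proof
    show "sl3_elt u1 u2 u3 \<in> G2" by (rule sl3_elt_in_G2 [OF detu])
    show "?s ** sl3_elt u1 u2 u3 = sl3_elt u1 u2 u3 ** torus_elt d1 d2 d3"
    proof (rule oct_matrix_eqI)
      fix a x y b
      have "lin3 c1 c2 c3 (lin3 u1 u2 u3 x) = lin3 u1 u2 u3 (vec3 (d1 * x$1) (d2 * x$2) (d3 * x$3))"
        unfolding lin3_def [of u1] lin3_linear u1 u2 u3 by (simp add: mult.commute)
      moreover have "cof3 c1 c2 c3 (cof3 u1 u2 u3 y) = cof3 u1 u2 u3 (vec3 (y$1 / d1) (y$2 / d2) (y$3 / d3))"
        unfolding lin3_def [of "u2 \<otimes> u3"] lin3_linear cof by simp
      ultimately show "(?s ** sl3_elt u1 u2 u3) *v zorn a x y b = (sl3_elt u1 u2 u3 ** torus_elt d1 d2 d3) *v zorn a x y b"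
        by (simp add: sl3_elt_zorn torus_elt_zorn flip: matrix_vector_mul_assoc)
    qed
  qed (fact d)
qed

theorem semisimple_conj_torus:
  assumes s: "s \<in> G2" "semisimple_elt s"
  obtains g t1 t2 t3 where "g \<in> G2" "t1 * t2 * t3 = 1" "s = g ** torus_elt t1 t2 t3 ** matrix_inv g"
proof -
  obtain e where e: "s *v e = e" "oct_trace e = 1" "oct_norm e = 0"
    using semisimple_fixes_idempotent [OF s] by blast
  obtain g where g: "g \<in> G2" "g *v idem = e" using G2_transitive_idempotents [OF e(2,3)] by blast
  let ?s = "matrix_inv g ** s ** g"
  have "?s \<in> G2" using G2_compose G2_inverse g s by blast
  moreover have "?s *v idem = matrix_inv g *v (g *v idem)" using g e by (simp flip: matrix_vector_mul_assoc)
  then have "?s *v idem = idem" using G2_inv_vec(1) [OF g(1)] by simp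
  ultimately obtain c1 c2 c3 where c: "det3 c1 c2 c3 = 1" "?s = sl3_elt c1 c2 c3"
    using G2_fixing_idem_is_sl3 by blast
  have "semisimple_elt (sl3_elt c1 c2 c3)"
    using semisimple_conjugate [OF s(2) G2_invertible [OF g(1)]] c by simp
  then obtain h t1 t2 t3 where h: "h \<in> G2" "t1 * t2 * t3 = 1" "?s ** h = h ** torus_elt t1 t2 t3"
    using semisimple_sl3_conj_torus [OF c(1)] c(2) by metis
  have "s ** (g ** h) = g ** (?s ** h)"
    using g by (metis G2_invertible matrix_inv_right matrix_mul_assoc matrix_mul_lid)
  also have "\<dots> = (g ** h) ** torus_elt t1 t2 t3" by (simp add: h matrix_mul_assoc)
  finally have *: "s ** (g ** h) = (g ** h) ** torus_elt t1 t2 t3" .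
  have gh: "g ** h \<in> G2" using G2_compose g h by blast
  have "s = s ** (g ** h) ** matrix_inv (g ** h)"
    by (metis gh G2_invertible matrix_inv_right matrix_mul_assoc matrix_mul_rid)
  then show ?thesis using that gh h * by metis
qed

section \<open>Polynomial curves\<close>

definition poly_fun :: "(complex \<Rightarrow> complex) \<Rightarrow> bool" where
  "poly_fun f \<longleftrightarrow> (\<exists>p. \<forall>z. f z = poly p z)"

named_theorems poly_fun_intros

lemma poly_fun_const [poly_fun_intros]: "poly_fun (\<lambda>z. c)"
  unfolding poly_fun_def by (rule exI [of _ "[:c:]"]) simp

lemma poly_fun_id [poly_fun_intros]: "poly_fun (\<lambda>z. z)"
  unfolding poly_fun_def by (rule exI [of _ "[:0, 1:]"]) simp

lemma poly_fun_add [poly_fun_intros]: "poly_fun f \<Longrightarrow> poly_fun g \<Longrightarrow> poly_fun (\<lambda>z. f z + g z)"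
  unfolding poly_fun_def by (metis poly_add)

lemma poly_fun_mult [poly_fun_intros]: "poly_fun f \<Longrightarrow> poly_fun g \<Longrightarrow> poly_fun (\<lambda>z. f z * g z)"
  unfolding poly_fun_def by (metis poly_mult)

lemma poly_fun_uminus [poly_fun_intros]: "poly_fun f \<Longrightarrow> poly_fun (\<lambda>z. - f z)"
  unfolding poly_fun_def by (metis poly_minus)

lemma poly_fun_diff [poly_fun_intros]: "poly_fun f \<Longrightarrow> poly_fun g \<Longrightarrow> poly_fun (\<lambda>z. f z - g z)"
  unfolding poly_fun_def by (metis poly_diff)

lemma poly_fun_sum [poly_fun_intros]: "(\<And>i. i \<in> I \<Longrightarrow> poly_fun (f i)) \<Longrightarrow> poly_fun (\<lambda>z. \<Sum>i\<in>I. f i z)"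
  by (induction I rule: infinite_finite_induct) (auto intro: poly_fun_intros)

lemma poly_fun_prod: "(\<And>i. i \<in> I \<Longrightarrow> poly_fun (f i)) \<Longrightarrow> poly_fun (\<lambda>z. \<Prod>i\<in>I. f i z)"
  by (induction I rule: infinite_finite_induct) (auto intro: poly_fun_intros)

lemma poly_eq_of_nonzero:
  fixes p q :: "complex poly"
  assumes "\<And>z. z \<noteq> 0 \<Longrightarrow> poly p z = poly q z" shows "p = q"
proof -
  have "\<forall>z. poly ([:0, 1:] * (p - q)) z = 0" using assms by auto
  then have "[:0, 1:] * (p - q) = 0" using poly_all_0_iff_0 by blast
  then show ?thesis by simp
qed

text \<open>A regular function on the projective line is constant: \<open>p\<close> and \<open>q\<close> are its expressions in the two charts.\<close>

lemma poly_fun_inversion_const: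
  assumes "poly_fun p" "poly_fun q" and eq: "\<And>z. z \<noteq> 0 \<Longrightarrow> p z = q (1 / z)"
  shows "p z = q w"
proof -
  obtain P Q where P: "\<And>z. p z = poly P z" and Q: "\<And>z. q z = poly Q z"
    using assms unfolding poly_fun_def by blast
  have "monom 1 (degree Q) * P = reflect_poly Q"
    by (rule poly_eq_of_nonzero)
      (use eq in \<open>simp add: poly_monom poly_reflect_poly_nz P Q inverse_eq_divide\<close>)
  moreover have "degree (monom 1 (degree Q) * P) = degree Q + degree P" if "P \<noteq> 0"
    using that by (simp add: degree_mult_eq degree_monom_eq)
  ultimately have "degree P = 0" using degree_reflect_poly_le [of Q] by fastforce
  then obtain c where c: "P = [:c:]" using degree_eq_zeroE by blast
  have "Q = [:c:]"
  proof (rule poly_eq_of_nonzero)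
    show "poly Q z = poly [:c:] z" if "z \<noteq> 0" for z
      using eq [of "1 / z"] that by (simp add: P Q c)
  qed
  with c show ?thesis by (simp add: P Q)
qed

text \<open>The same for a section of the line bundle of degree \<open>1\<close>.\<close>

lemma poly_fun_inversion_linear:
  assumes p: "poly_fun p" and q: "poly_fun q" and eq: "\<And>z. z \<noteq> 0 \<Longrightarrow> p z = z * q (1 / z)"
  shows "p z = p 0 + z * q 0"
proof -
  obtain P where P: "\<And>z. p z = poly P z" using p unfolding poly_fun_def by blast
  obtain a P' where P': "P = pCons a P'" by (rule pCons_cases)
  have "poly P' z = q (1 / z) - a * (1 / z)" if "z \<noteq> 0" for z
    using eq [OF that] that by (simp add: P P' field_simps)
  moreover have "poly_fun (poly P')" unfolding poly_fun_def by blast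
  moreover have "poly_fun (\<lambda>w. q w - a * w)" by (intro poly_fun_intros q)
  ultimately have "poly P' z = q 0 - a * 0"
    using poly_fun_inversion_const [of "poly P'" "\<lambda>w. q w - a * w"] by blast
  then show ?thesis by (simp add: P P')
qed

definition poly_curve :: "(complex \<Rightarrow> complex^'n^'m) \<Rightarrow> bool" where
  "poly_curve A \<longleftrightarrow> (\<forall>i j. poly_fun (\<lambda>z. A z $ i $ j))"

lemma poly_curve_det: "poly_curve A \<Longrightarrow> poly_fun (\<lambda>z. det (A z))"
  unfolding det_def poly_curve_def by (intro poly_fun_intros poly_fun_prod) blast

lemma regular_fun_poly_curve:
  assumes "regular_fun f" "poly_curve A" "poly_fun (\<lambda>z. inverse (det (A z)))"
  shows "poly_fun (\<lambda>z. f (A z))"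
  using assms(1) by induction (use assms in \<open>auto intro: poly_fun_intros simp: poly_curve_def\<close>)

text \<open>Of a one-parameter group only \<open>A z ** A (- z) = mat 1\<close> is required. It makes \<open>1 / det (A z)\<close> equal to
\<open>det (A (- z))\<close>, so that every regular function is polynomial along the curve.\<close>

definition root_curve :: "(complex \<Rightarrow> oct_matrix) \<Rightarrow> bool" where
  "root_curve A \<longleftrightarrow> poly_curve A \<and> (\<forall>z. A z \<in> G2 \<and> A z ** A (- z) = mat 1)"

lemma root_curve_inverse_det:
  assumes "root_curve A" shows "poly_fun (\<lambda>z. inverse (det (A z)))"
proof -
  obtain p where p: "\<And>z. det (A z) = poly p z"
    using assms poly_curve_det unfolding root_curve_def poly_fun_def by blast
  have "inverse (det (A z)) = poly p (- z)" for z
  proof -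
    have "det (A z) * det (A (- z)) = 1"
      using assms by (metis det_I det_mul root_curve_def)
    then show ?thesis by (metis inverse_unique p)
  qed
  moreover have "poly_fun (\<lambda>z. poly p (- z))"
    unfolding poly_fun_def by (rule exI [of _ "pcompose p [:0, -1:]"]) (simp add: poly_pcompose)
  ultimately show ?thesis by simp
qed

lemma matrix_axis: "(A *v axis j 1) $ i = A $ i $ j" for A :: "complex^'n^'m"
  by (simp add: matrix_vector_mult_def axis_def if_distrib [of "(*) _"] cong: if_cong)

lemma root_curveI:
  assumes "\<And>z. A z \<in> G2" "\<And>z. A z ** A (- z) = mat 1"
    and f: "\<And>a u v b z. A z *v zorn a u v b = zorn (f1 a u v b z) (f2 a u v b z) (f3 a u v b z) (f4 a u v b z)"
    and p: "\<And>a u v b. poly_fun (f1 a u v b)" "\<And>a u v b. poly_fun (f4 a u v b)"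
      "\<And>a u v b. poly_fun (\<lambda>z. f2 a u v b z $ 1)" "\<And>a u v b. poly_fun (\<lambda>z. f2 a u v b z $ 2)"
      "\<And>a u v b. poly_fun (\<lambda>z. f2 a u v b z $ 3)" "\<And>a u v b. poly_fun (\<lambda>z. f3 a u v b z $ 1)"
      "\<And>a u v b. poly_fun (\<lambda>z. f3 a u v b z $ 2)" "\<And>a u v b. poly_fun (\<lambda>z. f3 a u v b z $ 3)"
  shows "root_curve A"
proof -
  have "poly_fun (\<lambda>z. A z $ i $ j)" for i j
  proof -
    obtain a u v b where x: "axis j 1 = zorn a u v b" by (rule zorn_cases)
    have "poly_fun (\<lambda>z. zorn (f1 a u v b z) (f2 a u v b z) (f3 a u v b z) (f4 a u v b z) $ i)"
      by (cases i) (simp_all add: zorn_def p)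
    then show ?thesis by (simp add: x f flip: matrix_axis)
  qed
  then show ?thesis using assms(1,2) by (simp add: root_curve_def poly_curve_def)
qed

lemma root_curve_u_elt: "root_curve (\<lambda>z. u_elt (z *s w))"
proof (rule root_curveI)
  show "u_elt (z *s w) *v zorn a u v b = zorn (a + (z *s w) \<odot> v)
      (u - (a - b) *s (z *s w) - ((z *s w) \<odot> v) *s (z *s w)) (v + u \<otimes> (z *s w)) (b - (z *s w) \<odot> v)" for z a u v b
    by (rule u_elt_zorn)
  show "u_elt (z *s w) ** u_elt (- z *s w) = mat 1" for z
    by (rule oct_matrix_eqI) (simp add: u_elt_zorn vec3_simps algebra_simps flip: matrix_vector_mul_assoc)
qed (simp_all add: u_elt_in_G2 dot3_def cross_nth, (intro poly_fun_intros)+)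

lemma root_curve_v_elt: "root_curve (\<lambda>z. v_elt (z *s w))"
proof (rule root_curveI)
  show "v_elt (z *s w) *v zorn a u v b = zorn (a + (z *s w) \<odot> u)
      (u + v \<otimes> (z *s w)) (v + (b - a) *s (z *s w) - ((z *s w) \<odot> u) *s (z *s w)) (b - (z *s w) \<odot> u)" for z a u v b
    by (rule v_elt_zorn)
  show "v_elt (z *s w) ** v_elt (- z *s w) = mat 1" for z
    by (rule oct_matrix_eqI) (simp add: v_elt_zorn vec3_simps algebra_simps flip: matrix_vector_mul_assoc)
qed (simp_all add: v_elt_in_G2 dot3_def cross_nth, (intro poly_fun_intros)+)

lemma sl3_elt_mult:
  "sl3_elt c1 c2 c3 ** sl3_elt d1 d2 d3 = sl3_elt (lin3 c1 c2 c3 d1) (lin3 c1 c2 c3 d2) (lin3 c1 c2 c3 d3)"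
proof (rule oct_matrix_eqI)
  fix a u v b
  have "lin3 c1 c2 c3 (lin3 d1 d2 d3 u) = lin3 (lin3 c1 c2 c3 d1) (lin3 c1 c2 c3 d2) (lin3 c1 c2 c3 d3) u"
    by (simp add: lin3_def [of d1] lin3_linear) (simp add: lin3_def)
  moreover have "cof3 c1 c2 c3 (cof3 d1 d2 d3 v) = cof3 (lin3 c1 c2 c3 d1) (lin3 c1 c2 c3 d2) (lin3 c1 c2 c3 d3) v"
    by (simp add: lin3_cross lin3_def [of "d2 \<otimes> d3"] lin3_linear) (simp add: lin3_def)
  ultimately show "(sl3_elt c1 c2 c3 ** sl3_elt d1 d2 d3) *v zorn a u v b =
      sl3_elt (lin3 c1 c2 c3 d1) (lin3 c1 c2 c3 d2) (lin3 c1 c2 c3 d3) *v zorn a u v b"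
    by (simp add: sl3_elt_zorn flip: matrix_vector_mul_assoc)
qed

lemma sl3_elt_id: "sl3_elt e1 e2 e3 = mat 1"
  by (rule oct_matrix_eqI) (simp add: sl3_elt_zorn cross_basis, simp add: lin3_def vec3_eq_iff)

abbreviation sl2_upper :: "complex \<Rightarrow> oct_matrix" where
  "sl2_upper z \<equiv> sl3_elt e1 (vec3 z 1 0) e3"

abbreviation sl2_lower :: "complex \<Rightarrow> oct_matrix" where
  "sl2_lower z \<equiv> sl3_elt (vec3 1 z 0) e2 e3"

lemma root_curve_sl2_upper: "root_curve sl2_upper"
proof (rule root_curveI)
  show "sl2_upper z *v zorn a u v b = zorn a (lin3 e1 (vec3 z 1 0) e3 u) (cof3 e1 (vec3 z 1 0) e3 v) b" for z a u v b
    by (rule sl3_elt_zorn)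
  show "sl2_upper z ** sl2_upper (- z) = mat 1" for z
    unfolding sl3_elt_id [symmetric] sl3_elt_mult by (rule arg_cong3 [where f = sl3_elt]) (simp_all add: lin3_def vec3_eq_iff)
  show "sl2_upper z \<in> G2" for z
    by (rule sl3_elt_in_G2) (simp add: vec3_simps)
qed (simp_all add: lin3_def cross_nth, (intro poly_fun_intros)+)

lemma root_curve_sl2_lower: "root_curve sl2_lower"
proof (rule root_curveI)
  show "sl2_lower z *v zorn a u v b = zorn a (lin3 (vec3 1 z 0) e2 e3 u) (cof3 (vec3 1 z 0) e2 e3 v) b" for z a u v b
    by (rule sl3_elt_zorn)
  show "sl2_lower z ** sl2_lower (- z) = mat 1" for z
    unfolding sl3_elt_id [symmetric] sl3_elt_mult by (rule arg_cong3 [where f = sl3_elt]) (simp_all add: lin3_def vec3_eq_iff)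
  show "sl2_lower z \<in> G2" for z
    by (rule sl3_elt_in_G2) (simp add: vec3_simps)
qed (simp_all add: lin3_def cross_nth, (intro poly_fun_intros)+)

section \<open>The stabiliser of the highest weight vector\<close>

locale lambda1_rep =
  fixes \<rho> :: "oct_matrix \<Rightarrow> complex^'m^'m" and v0 :: "complex^'m"
  assumes rational: "rational_rep G2 \<rho>"
    and v0_nonzero: "v0 \<noteq> 0"
    and v0_root: "\<And>j z. j \<in> {1, 2} \<Longrightarrow> \<rho> (simple_root_elt j z) *v v0 = v0"
    and v0_coroot: "\<And>j z. j \<in> {1, 2} \<Longrightarrow> z \<noteq> 0 \<Longrightarrow>
      \<rho> (simple_coroot j z) *v v0 = (z powi fundamental_weight 1 j) *s v0"
begin

lemma rep_mult: "A \<in> G2 \<Longrightarrow> B \<in> G2 \<Longrightarrow> \<rho> (A ** B) = \<rho> A ** \<rho> B"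
  and rep_id: "\<rho> (mat 1) = mat 1"
  using rational by (simp_all add: rational_rep_def)

lemma rep_mult_vec: "A \<in> G2 \<Longrightarrow> B \<in> G2 \<Longrightarrow> \<rho> (A ** B) *v y = \<rho> A *v (\<rho> B *v y)"
  by (simp add: rep_mult matrix_vector_mul_assoc)

lemma rep_inverse_vec: "A \<in> G2 \<Longrightarrow> \<rho> (matrix_inv A) *v (\<rho> A *v y) = y"
  by (simp add: G2_inverse matrix_inv_left G2_invertible rep_id flip: rep_mult_vec)

lemma rep_poly_curve:
  assumes "root_curve A" shows "poly_fun (\<lambda>z. (\<rho> (A z) *v y) $ i)"
proof -
  have "poly_fun (\<lambda>z. \<rho> (A z) $ i $ j)" for j
  proof -
    obtain f where f: "regular_fun f" "\<And>B. B \<in> G2 \<Longrightarrow> \<rho> B $ i $ j = f B"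
      using rational unfolding rational_rep_def by blast
    have "poly_fun (\<lambda>z. f (A z))"
      using assms regular_fun_poly_curve [OF f(1)] root_curve_inverse_det unfolding root_curve_def by blast
    then show ?thesis using assms f(2) by (simp add: root_curve_def)
  qed
  then show ?thesis unfolding matrix_vector_mult_def by (auto intro!: poly_fun_intros)
qed

definition fixer :: "oct_matrix set" where
  "fixer = {g \<in> G2. \<rho> g *v v0 = v0}"

lemma fixer_mult: "g \<in> fixer \<Longrightarrow> h \<in> fixer \<Longrightarrow> g ** h \<in> fixer"
  by (simp add: fixer_def G2_compose rep_mult_vec)

lemma fixer_inverse: "g \<in> fixer \<Longrightarrow> matrix_inv g \<in> fixer"
  unfolding fixer_def using G2_inverse rep_inverse_vec [of g v0] by auto

lemma fixer_cancel:
  assumes "g ** h = k" "g \<in> fixer" "k \<in> fixer" shows "h \<in> fixer"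
proof -
  have "h = matrix_inv g ** k"
    using assms by (metis (no_types, lifting) G2_invertible fixer_def mem_Collect_eq matrix_inv_left matrix_mul_assoc matrix_mul_lid)
  then show ?thesis using assms fixer_mult fixer_inverse by simp
qed

lemma fixer_cancel_right:
  assumes "g ** h = k" "h \<in> fixer" "k \<in> fixer" shows "g \<in> fixer"
proof -
  have "g = k ** matrix_inv h"
    using assms by (metis (no_types, lifting) G2_invertible fixer_def mem_Collect_eq matrix_inv_right matrix_mul_assoc matrix_mul_rid)
  then show ?thesis using assms fixer_mult fixer_inverse by simp
qed

text \<open>The highest weight is \<open>\<lambda>\<^sub>1 = - \<epsilon>\<^sub>3\<close>, read off from the coroots, which generate the torus.\<close>

lemma rep_torus:
  assumes "t1 * t2 * t3 = 1" shows "\<rho> (torus_elt t1 t2 t3) *v v0 = (1 / t3) *s v0"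
proof -
  have nz: "t1 \<noteq> 0" "t2 \<noteq> 0" "t3 \<noteq> 0" using assms by auto
  have t2: "t2 = 1 / (t1 * t3)" using assms nz by (simp add: field_simps)
  have "torus_elt t1 t2 t3 = simple_coroot 1 (1 / t3) ** simple_coroot 2 (t1 / t3)"
    using nz by (simp add: simple_coroot_def torus_elt_mult t2 power2_eq_square mult.commute)
  then show ?thesis
    using v0_coroot [of 1 "1 / t3"] v0_coroot [of 2 "t1 / t3"] nz
    by (simp add: rep_mult_vec simple_coroot_in_G2 fundamental_weight_def)
qed

lemma sl2_upper_fixer: "sl2_upper z \<in> fixer"
proof -
  have "sl2_upper z = simple_root_elt 2 z"
    by (rule oct_matrix_eqI)
      (simp add: sl3_elt_zorn simple_root_elt_works, simp add: zorn_def oct_eq_iff lin3_def cross_nth)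
  then show ?thesis using v0_root [of 2] by (simp add: fixer_def simple_root_elt_in_G2)
qed

lemma u_elt_e2_fixer: "u_elt (z *s e2) \<in> fixer"
proof -
  have "u_elt (z *s e2) = simple_root_elt 1 z"
    by (rule oct_matrix_eqI)
      (simp add: u_elt_zorn simple_root_elt_works, simp add: zorn_def oct_eq_iff cross_nth dot3_def power2_eq_square algebra_simps)
  then show ?thesis using v0_root [of 1] by (simp add: fixer_def simple_root_elt_in_G2)
qed

text \<open>The weight \<open>\<lambda>\<^sub>1\<close> is orthogonal to the coroot of \<open>\<alpha>\<^sub>2\<close>. Hence the orbit map of \<open>v0\<close> under the
\<open>SL\<^sub>2\<close> of \<open>\<alpha>\<^sub>2\<close> is a regular function on the projective line with values in the representation, and it
is constant.\<close>

lemma sl2_lower_fixer: "sl2_lower z \<in> fixer"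
proof -
  let ?n = "sl3_elt e2 (- e1) e3"
  have n: "?n \<in> G2" by (rule sl3_elt_in_G2) (simp add: vec3_simps)
  have up: "sl2_upper w \<in> G2" for w using sl2_upper_fixer by (simp add: fixer_def)
  have low: "sl2_lower w \<in> G2" for w using root_curve_sl2_lower by (simp add: root_curve_def)
  have eq: "\<rho> (sl2_lower z) *v v0 = \<rho> (sl2_upper (1 / z)) *v (\<rho> ?n *v v0)" if "z \<noteq> 0" for z
  proof -
    have t: "torus_elt z (1 / z) 1 \<in> G2" using that by (intro torus_elt_in_G2) simp
    \<comment> \<open>The Bruhat decomposition in \<open>SL\<^sub>2\<close>; its torus part fixes \<open>v0\<close>.\<close>
    have "sl2_lower z = sl2_upper (1 / z) ** (?n ** (torus_elt z (1 / z) 1 ** sl2_upper (1 / z)))"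
      using that by (intro oct_matrix_eqI)
        (simp add: sl3_elt_zorn torus_elt_zorn lin3_def vec3_simps field_simps flip: matrix_vector_mul_assoc)
    then have "\<rho> (sl2_lower z) *v v0 =
        \<rho> (sl2_upper (1 / z)) *v (\<rho> ?n *v (\<rho> (torus_elt z (1 / z) 1) *v (\<rho> (sl2_upper (1 / z)) *v v0)))"
      by (simp add: rep_mult_vec up n t G2_compose)
    also have "\<rho> (sl2_upper (1 / z)) *v v0 = v0" using sl2_upper_fixer by (simp add: fixer_def)
    also have "\<rho> (torus_elt z (1 / z) 1) *v v0 = v0" using that by (simp add: rep_torus)
    finally show ?thesis .
  qed
  have "(\<rho> (sl2_lower z) *v v0) $ i = v0 $ i" for i
  proof -
    let ?p = "\<lambda>z. (\<rho> (sl2_lower z) *v v0) $ i" and ?q = "\<lambda>w. (\<rho> (sl2_upper w) *v (\<rho> ?n *v v0)) $ i"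
    have *: "?p z = ?q 0" for z
      by (rule poly_fun_inversion_const [of ?p ?q])
        (use eq in \<open>simp_all add: rep_poly_curve root_curve_sl2_lower root_curve_sl2_upper\<close>)
    from * [of z] * [of 0] show ?thesis by (simp add: sl3_elt_id rep_id)
  qed
  then show ?thesis by (simp add: fixer_def low vec_eq_iff)
qed

lemma sl2_fixer:
  assumes "p * s - q * r = 1" shows "sl3_elt (vec3 p r 0) (vec3 q s 0) e3 \<in> fixer"
proof -
  have gen: "sl3_elt (vec3 p r 0) (vec3 q s 0) e3 \<in> fixer" if "p * s - q * r = 1" "r \<noteq> 0" for p q r s
  proof -
    have q: "q = (p * s - 1) / r" using that by (simp add: field_simps)
    have "sl3_elt (vec3 p r 0) (vec3 q s 0) e3 =
        sl2_upper ((p - 1) / r) ** sl2_lower r ** sl2_upper ((s - 1) / r)"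
      unfolding sl3_elt_mult using that(2)
      by (intro arg_cong3 [where f = sl3_elt]) (simp_all add: lin3_def vec3_eq_iff q field_simps)
    then show ?thesis by (simp add: fixer_mult sl2_lower_fixer sl2_upper_fixer)
  qed
  show ?thesis
  proof (cases "r = 0")
    case False then show ?thesis using gen assms by blast
  next
    case True
    with assms have "p \<noteq> 0" "p * s = 1" by auto
    then have "sl3_elt (vec3 p p 0) (vec3 q (q + s) 0) e3 \<in> fixer"
      by (intro gen) (simp_all add: algebra_simps)
    moreover have "sl2_lower 1 ** sl3_elt (vec3 p r 0) (vec3 q s 0) e3 = sl3_elt (vec3 p p 0) (vec3 q (q + s) 0) e3"
      unfolding sl3_elt_mult by (intro arg_cong3 [where f = sl3_elt]) (simp_all add: lin3_def vec3_eq_iff True)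
    ultimately show ?thesis using fixer_cancel sl2_lower_fixer by blast
  qed
qed

lemma u_elt_conj:
  assumes "det3 c1 c2 c3 = 1"
  shows "sl3_elt c1 c2 c3 ** u_elt w = u_elt (lin3 c1 c2 c3 w) ** sl3_elt c1 c2 c3"
  by (rule oct_matrix_eqI)
    (simp add: sl3_elt_zorn u_elt_zorn lin3_linear lin3_cross lin3_dot_cof3 assms flip: matrix_vector_mul_assoc)

text \<open>The \<open>SL\<^sub>2\<close> of \<open>\<alpha>\<^sub>2\<close> rotates the simple root group of \<open>\<alpha>\<^sub>1 = \<epsilon>\<^sub>2\<close> into every direction spanned by the
root vectors of \<open>\<epsilon>\<^sub>1\<close> and \<open>\<epsilon>\<^sub>2\<close>.\<close>

lemma u_elt_fixer: "u_elt (vec3 p q 0) \<in> fixer"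
proof (cases "p = 0")
  case True
  then have "vec3 p q 0 = q *s e2" by (simp add: vec3_eq_iff)
  then show ?thesis using u_elt_e2_fixer by simp
next
  case False
  let ?s = "sl3_elt (vec3 0 (- 1 / p) 0) (vec3 p q 0) e3"
  have s: "?s \<in> fixer" using False by (intro sl2_fixer) simp
  have "?s ** u_elt (1 *s e2) = u_elt (lin3 (vec3 0 (- 1 / p) 0) (vec3 p q 0) e3 (1 *s e2)) ** ?s"
    using False by (intro u_elt_conj) (simp add: vec3_simps)
  moreover have "lin3 (vec3 0 (- 1 / p) 0) (vec3 p q 0) e3 (1 *s e2) = vec3 p q 0"
    by (simp add: lin3_def vec3_eq_iff)
  ultimately show ?thesis
    using fixer_cancel_right fixer_mult [OF s u_elt_e2_fixer] s by metis
qed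

text \<open>The root groups of \<open>\<epsilon>\<^sub>1 - \<epsilon>\<^sub>3\<close> and \<open>\<epsilon>\<^sub>2 - \<epsilon>\<^sub>3\<close> arise as commutators: \<open>?z\<close> below is an element of the root group
of \<open>- \<epsilon>\<^sub>3\<close> up to long root elements, and its commutator with \<open>u_elt w\<close> is the long root element
with third column \<open>e3 + 3 w\<close>, by the structure constant \<open>3\<close> of type \<open>G\<^sub>2\<close>.\<close>

lemma long_root_fixer: "sl3_elt e1 e2 (vec3 p q 1) \<in> fixer"
proof -
  let ?z = "u_elt (vec3 (- 1) (- 1) 0) ** u_elt e2 ** u_elt e1"
  let ?y = "u_elt (vec3 (p / 3) (q / 3) 0)"
  have "sl3_elt e1 e2 (vec3 p q 1) ** (?y ** ?z) = ?z ** ?y"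
    by (rule oct_matrix_eqI)
      (simp add: sl3_elt_zorn u_elt_zorn lin3_def vec3_simps algebra_simps flip: matrix_vector_mul_assoc)
  then show ?thesis
    using fixer_cancel_right by (metis fixer_mult u_elt_fixer)
qed

text \<open>The stabiliser of \<open>V3\<close> is the derived group of a maximal parabolic subgroup. An element \<open>g\<close> of it is
multiplied by elements already known to fix \<open>v0\<close> until it fixes \<open>E1\<close>; it then lies in \<open>SL\<^sub>3\<close>, and fixing
\<open>V3\<close> splits it into a long root element and an element of the \<open>SL\<^sub>2\<close> of \<open>\<alpha>\<^sub>2\<close>.\<close>

lemma hwv_stabiliser:
  assumes g: "g \<in> G2" "g *v hwv = hwv" shows "g \<in> fixer"
proof -
  obtain a u v b where e: "g *v idem = zorn a u v b" by (rule zorn_cases)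
  have "(g *v idem) \<star> hwv = 0"
    using G2_mult [OF g(1), of idem hwv] by (simp add: g zorn_mult dot_algebra cross_algebra zorn_0)
  then have 0: "u$3 = 0" "v$1 = 0" "v$2 = 0" "b = 0"
    by (simp_all add: e zorn_mult vec3_simps)
  have "a = 1" using G2_trace [OF g(1), of idem] by (simp add: e 0)
  define w where "w = vec3 (u$1) (u$2) 0"
  define c where "c = v$3"
  have e': "g *v idem = zorn 1 w (vec3 0 0 c) 0"
    by (simp add: e 0 \<open>a = 1\<close> w_def c_def vec3_eq_iff)
  \<comment> \<open>The factor \<open>u_elt w\<close> clears the upper vector of \<open>g *v idem\<close>, the other three clear its lower vector \<open>c e\<^sub>3\<close>.\<close>
  let ?h = "u_elt (vec3 (- c) (- 1) 0) ** (u_elt e2 ** (u_elt (vec3 c 0 0) ** u_elt w))"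
  have hf: "?h \<in> fixer" unfolding w_def by (intro fixer_mult u_elt_fixer)
  have "?h *v zorn 1 w (vec3 0 0 c) 0 = idem" "?h *v hwv = hwv"
    unfolding w_def by (simp_all add: u_elt_zorn vec3_simps algebra_simps flip: matrix_vector_mul_assoc)
  then have h: "(?h ** g) *v idem = idem" "(?h ** g) *v hwv = hwv"
    by (simp_all add: e' g flip: matrix_vector_mul_assoc)
  have "?h ** g \<in> G2" using hf g G2_compose by (simp add: fixer_def)
  then obtain c1 c2 c3 where c: "det3 c1 c2 c3 = 1" "?h ** g = sl3_elt c1 c2 c3"
    using G2_fixing_idem_is_sl3 h(1) by blast
  have c12: "c1 \<otimes> c2 = e3" using h(2) by (simp add: c(2) sl3_elt_zorn lin3_linear) (simp add: lin3_def)
  have c13: "c1$3 = 0" "c2$3 = 0" "c3$3 = 1"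
    using dot_cross_self(1,2)[of c1 c2] dot_cross_self(2) [of c2 c1] c(1) det3_rotate(2) [of c3 c1 c2]
    by (simp_all add: c12) (simp_all add: dot3_def)
  have "c1$1 * c2$2 - c2$1 * c1$2 = 1" using c12 by (simp add: vec3_simps mult.commute)
  then have "sl3_elt (vec3 (c1$1) (c1$2) 0) (vec3 (c2$1) (c2$2) 0) e3 \<in> fixer" by (rule sl2_fixer)
  then have "sl3_elt e1 e2 (vec3 (c3$1) (c3$2) 1) ** sl3_elt (vec3 (c1$1) (c1$2) 0) (vec3 (c2$1) (c2$2) 0) e3 \<in> fixer"
    by (intro fixer_mult long_root_fixer)
  moreover have "sl3_elt e1 e2 (vec3 (c3$1) (c3$2) 1) ** sl3_elt (vec3 (c1$1) (c1$2) 0) (vec3 (c2$1) (c2$2) 0) e3 = sl3_elt c1 c2 c3"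
    unfolding sl3_elt_mult by (intro arg_cong3 [where f = sl3_elt]) (simp_all add: lin3_def vec3_eq_iff c13)
  ultimately show ?thesis using c(2) hf fixer_cancel by metis
qed

end

section \<open>The octonions of trace zero as the representation\<close>

definition null_vec :: "octonion \<Rightarrow> bool" where
  "null_vec x \<longleftrightarrow> oct_trace x = 0 \<and> oct_norm x = 0"

lemma null_vec_zorn [simp]: "null_vec (zorn a u v b) \<longleftrightarrow> b = - a \<and> u \<odot> v = - (a * a)"
  by (auto simp: null_vec_def add_eq_0_iff)

lemma null_vec_G2 [simp]: "g \<in> G2 \<Longrightarrow> null_vec (g *v x) \<longleftrightarrow> null_vec x"
  by (simp add: null_vec_def G2_trace G2_norm)

lemma null_vec_scale: "null_vec x \<Longrightarrow> null_vec (c *s x)"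
  by (simp add: null_vec_def oct_trace_linear oct_norm_scale)

context lambda1_rep
begin

text \<open>The map \<open>g V3 \<mapsto> \<rho> g v0\<close>. The value at \<open>0\<close> makes it homogeneous on the whole cone of null vectors.\<close>

definition null_map :: "octonion \<Rightarrow> complex^'m" where
  "null_map x = (if x = 0 then 0 else \<rho> (SOME g. g \<in> G2 \<and> g *v hwv = x) *v v0)"

lemma null_map_0 [simp]: "null_map 0 = 0"
  by (simp add: null_map_def)

lemma G2_vec_eq_0_iff [simp]: "g \<in> G2 \<Longrightarrow> g *v x = 0 \<longleftrightarrow> x = 0"
  by (metis G2_inv_vec(1) vec.zero)

lemma hwv_nonzero: "hwv \<noteq> 0"
  by (simp add: vec3_eq_iff)

lemma null_map_orbit:
  assumes g: "g \<in> G2" shows "null_map (g *v hwv) = \<rho> g *v v0"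
proof -
  define h where "h = (SOME h. h \<in> G2 \<and> h *v hwv = g *v hwv)"
  have "h \<in> G2 \<and> h *v hwv = g *v hwv"
    unfolding h_def by (rule someI_ex) (use g in blast)
  then have h: "h \<in> G2" "h *v hwv = g *v hwv" by auto
  have "matrix_inv g ** h \<in> fixer"
    by (rule hwv_stabiliser) (simp_all add: G2_compose G2_inverse g h flip: matrix_vector_mul_assoc)
  then have "\<rho> g *v (\<rho> (matrix_inv g ** h) *v v0) = \<rho> g *v v0" by (simp add: fixer_def)
  moreover have "g ** (matrix_inv g ** h) = h"
    by (simp add: matrix_mul_assoc matrix_inv_right G2_invertible g)
  ultimately have "\<rho> h *v v0 = \<rho> g *v v0"
    using g h by (metis G2_compose G2_inverse rep_mult_vec)
  then show ?thesis using g hwv_nonzero by (simp add: null_map_def h_def)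
qed

lemma null_map_equivariant:
  assumes g: "g \<in> G2" and x: "null_vec x" shows "null_map (g *v x) = \<rho> g *v null_map x"
proof (cases "x = 0")
  case False
  then obtain h where h: "h \<in> G2" "h *v hwv = x"
    using G2_transitive_null x unfolding null_vec_def by blast
  have "null_map (g *v x) = null_map ((g ** h) *v hwv)"
    by (simp add: h(2) flip: matrix_vector_mul_assoc)
  also have "\<dots> = \<rho> (g ** h) *v v0"
    by (rule null_map_orbit) (simp add: G2_compose g h)
  also have "\<dots> = \<rho> g *v null_map x"
    using null_map_orbit [OF h(1)] by (simp add: rep_mult_vec g h)
  finally show ?thesis .
qed simp

text \<open>Scaling \<open>V3\<close> is the action of a torus element, and \<open>V3\<close> and \<open>v0\<close> have the same weight.\<close>

lemma null_map_scale:
  assumes x: "null_vec x" shows "null_map (c *s x) = c *s null_map x"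
proof (cases "x = 0 \<or> c = 0")
  case False
  then obtain h where h: "h \<in> G2" "h *v hwv = x"
    using G2_transitive_null x unfolding null_vec_def by blast
  let ?t = "torus_elt c 1 (1 / c)"
  have t: "?t \<in> G2" using False by (intro torus_elt_in_G2) simp
  have "?t *v hwv = c *s hwv"
    by (simp add: torus_elt_zorn zorn_scale vec3_eq_iff)
  then have "null_map (c *s x) = null_map ((h ** ?t) *v hwv)"
    using h(2) by (simp add: vec.scale flip: matrix_vector_mul_assoc)
  also have "\<dots> = \<rho> (h ** ?t) *v v0" by (rule null_map_orbit) (simp add: G2_compose h t)
  also have "\<dots> = \<rho> h *v (c *s v0)"
    using False by (simp add: rep_mult_vec h t rep_torus)
  also have "\<dots> = c *s null_map x" using null_map_orbit [OF h(1)] by (simp add: vec.scale h(2))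
  finally show ?thesis .
qed auto

lemma null_map_nonzero:
  assumes x: "null_vec x" "x \<noteq> 0" shows "null_map x \<noteq> 0"
proof -
  obtain h where h: "h \<in> G2" "h *v hwv = x"
    using G2_transitive_null x unfolding null_vec_def by blast
  have "\<rho> (matrix_inv h) *v null_map x = v0"
    using null_map_orbit [OF h(1)] h rep_inverse_vec by simp
  then show ?thesis using v0_nonzero by auto
qed

definition additive_pair :: "octonion \<Rightarrow> octonion \<Rightarrow> bool" where
  "additive_pair x y \<longleftrightarrow> null_vec x \<and> null_vec y \<and>
     (\<forall>z. null_vec (x + z *s y) \<and> null_map (x + z *s y) = null_map x + z *s null_map y)"

lemma additive_pair_sum: "additive_pair x y \<Longrightarrow> null_map (x + y) = null_map x + null_map y"
  unfolding additive_pair_def by (metis vec.scale_one)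

text \<open>Transport by the two curves expresses \<open>null_map\<close> on the projective line spanned by \<open>x\<close> and \<open>y\<close> as a
polynomial in each chart, homogeneous of degree \<open>1\<close>.\<close>

lemma additive_pair_root_curves:
  assumes x: "null_vec x" and y: "null_vec y" and A: "root_curve A" and B: "root_curve B"
    and Ax: "\<And>z. A z *v x = x + z *s y" and By: "\<And>z. B z *v y = y + z *s x"
  shows "additive_pair x y"
proof -
  have AB: "A z \<in> G2" "B z \<in> G2" for z using A B by (simp_all add: root_curve_def)
  have null: "null_vec (x + z *s y)" for z using null_vec_G2 [OF AB(1)] x Ax by metis
  have "null_map (x + z *s y) $ i = (null_map x + z *s null_map y) $ i" for z i
  proof -
    let ?p = "\<lambda>z. (\<rho> (A z) *v null_map x) $ i" and ?q = "\<lambda>z. (\<rho> (B z) *v null_map y) $ i"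
    have p: "?p z = null_map (x + z *s y) $ i" for z
      using null_map_equivariant [OF AB(1) x] by (simp add: Ax)
    have q: "?q z = null_map (y + z *s x) $ i" for z
      using null_map_equivariant [OF AB(2) y] by (simp add: By)
    have "?p z = z * ?q (1 / z)" if "z \<noteq> 0" for z
    proof -
      have "x + z *s y = z *s (y + (1 / z) *s x)" using that by (simp add: vec.scale_right_distrib add.commute)
      moreover have "null_vec (y + (1 / z) *s x)" using null_vec_G2 [OF AB(2)] y By by metis
      ultimately have "null_map (x + z *s y) = z *s null_map (y + (1 / z) *s x)"
        by (simp only: null_map_scale)
      then show ?thesis unfolding p q by simp
    qed
    then have "?p z = ?p 0 + z * ?q 0"
      by (intro poly_fun_inversion_linear rep_poly_curve A B)
    then show ?thesis unfolding p q by simp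
  qed
  then show ?thesis using x y null by (simp add: additive_pair_def vec_eq_iff)
qed

lemma additive_pair_G2:
  assumes g: "g \<in> G2" and pair: "additive_pair x y" shows "additive_pair (g *v x) (g *v y)"
proof -
  have "g *v x + z *s (g *v y) = g *v (x + z *s y)" for z by (simp add: vec.add vec.scale)
  then show ?thesis
    using pair unfolding additive_pair_def by (simp add: g null_map_equivariant) (simp add: vec.add vec.scale)
qed

lemma additive_pair_G2_cancel:
  assumes g: "g \<in> G2" and "additive_pair (g *v x) (g *v y)" shows "additive_pair x y"
  using additive_pair_G2 [OF G2_inverse [OF g] assms(2)] g by simp

lemma additive_pair_uminus:
  assumes "additive_pair x y" shows "additive_pair (- x) (- y)"
proof -
  have neg: "null_vec (- x) \<and> null_map (- x) = - null_map x" if "null_vec x" for x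
    using null_vec_scale [OF that, of "- 1"] null_map_scale [OF that, of "- 1"] by simp
  have "null_vec (- x + z *s - y) \<and> null_map (- x + z *s - y) = null_map (- x) + z *s null_map (- y)" for z
  proof -
    have sum: "null_vec (x + z *s y)" "null_map (x + z *s y) = null_map x + z *s null_map y"
      and "null_vec x" "null_vec y"
      using assms unfolding additive_pair_def by blast+
    then have n: "null_map (- x) = - null_map x" "null_map (- y) = - null_map y" using neg by blast+
    have eq: "- x + z *s - y = - (x + z *s y)" by simp
    have "null_map (- (x + z *s y)) = - null_map x + z *s - null_map y"
      unfolding conjunct2 [OF neg [OF sum(1)]] sum(2) by simp
    then show ?thesis unfolding eq n using neg [OF sum(1)] by blast
  qed
  then show ?thesis using assms neg unfolding additive_pair_def by blast
qed

lemma sl3_basis: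
  "sl3_elt c1 c2 c3 *v zorn a e1 0 b = zorn a c1 0 b" "sl3_elt c1 c2 c3 *v zorn a e2 0 b = zorn a c2 0 b"
  "sl3_elt c1 c2 c3 *v zorn 0 0 e2 0 = zorn 0 0 (c3 \<otimes> c1) 0"
  by (simp_all add: sl3_elt_zorn lin3_linear) (simp_all add: lin3_def)

text \<open>The independent pairs of upper vectors form one orbit of \<open>SL\<^sub>3\<close>, so a single pair and its long root
groups suffice.\<close>

lemma additive_pair_upper:
  assumes "u \<otimes> w \<noteq> 0" shows "additive_pair (zorn 0 u 0 0) (zorn 0 w 0 0)"
proof -
  obtain c where c: "c \<odot> (u \<otimes> w) = 1" using exists_dot_eq [OF assms] by blast
  have "additive_pair (zorn 0 e1 0 0) (zorn 0 e2 0 0)"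
    by (rule additive_pair_root_curves [OF _ _ root_curve_sl2_lower root_curve_sl2_upper])
      (simp_all add: dot_algebra sl3_basis zorn_add zorn_scale, simp_all add: vec3_eq_iff)
  moreover have "sl3_elt u w c \<in> G2" by (rule sl3_elt_in_G2) (use c det3_rotate in metis)
  ultimately have "additive_pair (sl3_elt u w c *v zorn 0 e1 0 0) (sl3_elt u w c *v zorn 0 e2 0 0)"
    by (rule additive_pair_G2 [rotated])
  then show ?thesis by (simp only: sl3_basis)
qed

text \<open>As before, with \<open>SL\<^sub>3\<close> acting transitively on orthogonal pairs of an upper and a lower vector, and the
short root groups of \<open>\<plusminus> \<epsilon>\<^sub>3\<close> joining \<open>U1\<close> and \<open>V2\<close>.\<close>

lemma additive_pair_upper_lower:
  assumes "u \<noteq> 0" "v \<noteq> 0" "u \<odot> v = 0" shows "additive_pair (zorn 0 u 0 0) (zorn 0 0 v 0)"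
proof -
  obtain c3 where c3: "c3 \<otimes> u = v" using exists_cross_eq assms by blast
  obtain c2 where c2: "c2 \<odot> v = 1" using exists_dot_eq [OF assms(2)] by blast
  have "additive_pair (zorn 0 e1 0 0) (zorn 0 0 e2 0)"
    by (rule additive_pair_root_curves [OF _ _ root_curve_u_elt [of "- e3"] root_curve_v_elt [of e3]])
      (simp_all add: dot_algebra u_elt_zorn v_elt_zorn zorn_add zorn_scale, simp_all add: vec3_simps)
  moreover have "sl3_elt u c2 c3 \<in> G2"
    by (rule sl3_elt_in_G2) (use c2 c3 det3_rotate in metis)
  ultimately have "additive_pair (sl3_elt u c2 c3 *v zorn 0 e1 0 0) (sl3_elt u c2 c3 *v zorn 0 0 e2 0)"
    by (rule additive_pair_G2 [rotated])
  then show ?thesis by (simp only: sl3_basis c3)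
qed

lemma additive_pair_lower:
  assumes "v \<otimes> w \<noteq> 0" shows "additive_pair (zorn 0 0 v 0) (zorn 0 0 w 0)"
  using additive_pair_uminus [OF additive_pair_upper [OF assms]]
  by - (rule additive_pair_G2_cancel [OF swap_elt_in_G2], simp add: swap_elt_zorn zorn_uminus)

text \<open>Up to \<open>SL\<^sub>3\<close> there is one such pair, and two short root elements move it to a pair of lower vectors.\<close>

lemma additive_pair_mixed_upper:
  assumes uv: "u \<odot> v = - 1" and wv: "w \<odot> v = 0" and w: "w \<noteq> 0"
  shows "additive_pair (zorn 1 u v (- 1)) (zorn 0 w 0 0)"
proof -
  let ?x = "zorn 1 e1 (- e1) (- 1)" and ?y = "zorn 0 e2 0 0"
  have "additive_pair (zorn 0 0 (- e1) 0) (zorn 0 0 (- e3) 0)"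
    by (rule additive_pair_lower) (simp add: vec3_simps)
  moreover have "v_elt e1 *v (u_elt e1 *v ?x) = zorn 0 0 (- e1) 0"
    "v_elt e1 *v (u_elt e1 *v ?y) = zorn 0 0 (- e3) 0"
    unfolding u_elt_zorn v_elt_zorn by (simp_all add: vec3_simps)
  ultimately have pair: "additive_pair ?x ?y"
    using additive_pair_G2_cancel u_elt_in_G2 v_elt_in_G2 by metis
  obtain c where c: "c \<otimes> w = v" using exists_cross_eq [OF w wv] by blast
  have c': "w \<otimes> c = - v" using cross_anticommute [of w c] c by simp
  have "sl3_elt u w c \<in> G2" by (rule sl3_elt_in_G2) (simp add: c' dot_algebra uv)
  then have "additive_pair (sl3_elt u w c *v ?x) (sl3_elt u w c *v ?y)"
    using pair by (rule additive_pair_G2)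
  moreover have "sl3_elt u w c *v ?x = zorn 1 u v (- 1)"
    by (simp add: sl3_elt_zorn lin3_linear) (simp add: lin3_def c')
  ultimately show ?thesis by (simp only: sl3_basis)
qed

lemma additive_pair_mixed_lower:
  assumes uv: "u \<odot> v = - 1" and uw: "u \<odot> w = 0" and w: "w \<noteq> 0"
  shows "additive_pair (zorn 1 u v (- 1)) (zorn 0 0 w 0)"
proof -
  have "additive_pair (zorn 1 v u (- 1)) (zorn 0 w 0 0)"
    by (rule additive_pair_mixed_upper) (use assms in \<open>simp_all add: dot_commute\<close>)
  from additive_pair_uminus [OF this] show ?thesis
    by - (rule additive_pair_G2_cancel [OF swap_elt_in_G2], simp add: swap_elt_zorn zorn_uminus)
qed

definition upper_map :: "complex^3 \<Rightarrow> complex^'m" where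
  "upper_map u = null_map (zorn 0 u 0 0)"

definition lower_map :: "complex^3 \<Rightarrow> complex^'m" where
  "lower_map v = null_map (zorn 0 0 v 0)"

lemma upper_map_scale: "upper_map (c *s u) = c *s upper_map u"
  using null_map_scale [of "zorn 0 u 0 0" c] by (simp add: upper_map_def zorn_scale dot_algebra)

lemma lower_map_scale: "lower_map (c *s u) = c *s lower_map u"
  using null_map_scale [of "zorn 0 0 u 0" c] by (simp add: lower_map_def zorn_scale dot_algebra)

lemma upper_map_add: "upper_map (u + w) = upper_map u + upper_map w"
proof (cases "u \<otimes> w = 0")
  case False
  then show ?thesis
    using additive_pair_sum [OF additive_pair_upper] by (simp add: upper_map_def zorn_add)
next
  case True
  show ?thesis
  proof (cases "u = 0")
    case True then show ?thesis using upper_map_scale [of 0 0] by simp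
  next
    case False
    then obtain k where "w = k *s u" using cross_eq_0_imp_scale \<open>u \<otimes> w = 0\<close> by blast
    then have "u + w = (1 + k) *s u" by (simp add: vec.scale_left_distrib)
    then show ?thesis using \<open>w = k *s u\<close> by (simp only: upper_map_scale) (simp add: vec.scale_left_distrib)
  qed
qed

lemma lower_map_add: "lower_map (u + w) = lower_map u + lower_map w"
proof (cases "u \<otimes> w = 0")
  case False
  then show ?thesis
    using additive_pair_sum [OF additive_pair_lower] by (simp add: lower_map_def zorn_add)
next
  case True
  show ?thesis
  proof (cases "u = 0")
    case True then show ?thesis using lower_map_scale [of 0 0] by simp
  next
    case False
    then obtain k where "w = k *s u" using cross_eq_0_imp_scale \<open>u \<otimes> w = 0\<close> by blast
    then have "u + w = (1 + k) *s u" by (simp add: vec.scale_left_distrib)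
    then show ?thesis using \<open>w = k *s u\<close> by (simp only: lower_map_scale) (simp add: vec.scale_left_distrib)
  qed
qed

text \<open>The value that a linear extension of \<open>null_map\<close> must take at \<open>E1 - E2\<close>, which is not a null vector.\<close>

definition middle :: "complex^3 \<Rightarrow> complex^3 \<Rightarrow> complex^'m" where
  "middle u v = null_map (zorn 1 u v (- 1)) - upper_map u - lower_map v"

lemma middle_upper:
  assumes "u \<odot> v = - 1" "w \<odot> v = - 1" shows "middle u v = middle w v"
proof (cases "w = u")
  case False
  have "additive_pair (zorn 1 u v (- 1)) (zorn 0 (w - u) 0 0)"
    by (rule additive_pair_mixed_upper) (use assms False in \<open>simp_all add: dot_algebra\<close>)
  from additive_pair_sum [OF this]
  have "null_map (zorn 1 w v (- 1)) = null_map (zorn 1 u v (- 1)) + upper_map (w - u)"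
    by (simp add: zorn_add upper_map_def)
  moreover have "upper_map w = upper_map u + upper_map (w - u)" by (simp flip: upper_map_add)
  ultimately show ?thesis by (simp add: middle_def)
qed simp

lemma middle_lower:
  assumes "u \<odot> v = - 1" "u \<odot> w = - 1" shows "middle u v = middle u w"
proof (cases "w = v")
  case False
  have "additive_pair (zorn 1 u v (- 1)) (zorn 0 0 (w - v) 0)"
    by (rule additive_pair_mixed_lower) (use assms False in \<open>simp_all add: dot_algebra\<close>)
  from additive_pair_sum [OF this]
  have "null_map (zorn 1 u w (- 1)) = null_map (zorn 1 u v (- 1)) + lower_map (w - v)"
    by (simp add: zorn_add lower_map_def)
  moreover have "lower_map w = lower_map v + lower_map (w - v)" by (simp flip: lower_map_add)
  ultimately show ?thesis by (simp add: middle_def)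
qed simp

text \<open>Adding an upper vector orthogonal to \<open>v\<close> does not change \<open>middle u v\<close>, so it depends only on \<open>v\<close>;
likewise it depends only on \<open>u\<close>. If \<open>v\<close> and \<open>v'\<close> are independent, some \<open>w\<close> has product \<open>-1\<close>
with both and links the two pairs; dependent ones are linked through a third vector.\<close>

lemma middle_const:
  assumes uv: "u \<odot> v = - 1" and uv': "u' \<odot> v' = - 1" shows "middle u v = middle u' v'"
proof -
  have indep: "middle u v = middle u' v'"
    if "u \<odot> v = - 1" "u' \<odot> v' = - 1" and v: "v \<otimes> v' \<noteq> 0" for u v u' v'
  proof -
    obtain m where m: "m \<odot> (v \<otimes> v') = - 1" using exists_dot_eq [OF v] by blast
    \<comment> \<open>Both products equal the determinant of \<open>m\<close>, \<open>v\<close> and \<open>v'\<close>.\<close>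
    define w where "w = v' \<otimes> m + m \<otimes> v"
    have "w \<odot> v = m \<odot> (v \<otimes> v')" "w \<odot> v' = m \<odot> (v \<otimes> v')"
      by (simp_all add: w_def vec3_simps algebra_simps)
    then have "w \<odot> v = - 1" "w \<odot> v' = - 1" using m by simp_all
    then show ?thesis using that middle_upper middle_lower by metis
  qed
  show ?thesis
  proof (cases "v \<otimes> v' = 0")
    case False then show ?thesis using indep assms by blast
  next
    case True
    have v: "v \<noteq> 0" "v' \<noteq> 0" using assms by (auto simp: dot_algebra)
    then obtain k where k: "v' = k *s v" using True cross_eq_0_imp_scale by blast
    obtain y where y: "v \<otimes> y \<noteq> 0" using exists_cross_nonzero v by blast
    then have "y \<noteq> 0" by (auto simp: cross_algebra)
    then obtain w where w: "w \<odot> y = - 1" using exists_dot_eq by blast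
    have "v' \<otimes> y \<noteq> 0" using y v k by (auto simp: cross_algebra)
    then show ?thesis using indep [OF uv w y] indep [OF uv' w] by simp
  qed
qed

definition rep_map :: "octonion \<Rightarrow> complex^'m" where
  "rep_map x = ((x$E1 - x$E2) / 2) *s middle e1 (- e1) + upper_map (upper x) + lower_map (lower x)"

lemma rep_map_add: "rep_map (x + y) = rep_map x + rep_map y"
  by (cases x; cases y)
    (simp add: rep_map_def zorn_add upper_map_add lower_map_add add_divide_distrib diff_divide_distrib
      vec.scale_left_distrib vec.scale_left_diff_distrib)

lemma rep_map_scale: "rep_map (c *s x) = c *s rep_map x"
  by (cases x)
    (simp add: rep_map_def zorn_scale upper_map_scale lower_map_scale vec.scale_right_distrib
      vec.scale_left_diff_distrib vec.scale_right_diff_distrib diff_divide_distrib)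

lemma rep_map_null:
  assumes "null_vec x" shows "rep_map x = null_map x"
proof -
  obtain a u v b where "x = zorn a u v b" by (rule zorn_cases)
  with assms have x: "x = zorn a u v (- a)" and uv: "u \<odot> v = - (a * a)" by simp_all
  have 0: "upper_map 0 = 0" "lower_map 0 = 0" using upper_map_scale [of 0 0] lower_map_scale [of 0 0] by simp_all
  show ?thesis
  proof (cases "a = 0")
    case True
    then consider "u = 0" | "v = 0" | "u \<noteq> 0" "v \<noteq> 0" "u \<odot> v = 0" using uv by auto
    then have "null_map x = upper_map u + lower_map v"
    proof cases
      case 3
      from additive_pair_sum [OF additive_pair_upper_lower [OF this]] show ?thesis
        by (simp add: x True zorn_add upper_map_def lower_map_def)
    qed (simp_all add: x True upper_map_def lower_map_def zorn_0)
    then show ?thesis by (simp add: rep_map_def x True)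
  next
    case False
    let ?u = "(1 / a) *s u" and ?v = "(1 / a) *s v"
    have uv': "?u \<odot> ?v = - 1" using uv False by (simp add: dot_algebra)
    then have null: "null_vec (zorn 1 ?u ?v (- 1))" by simp
    have "middle ?u ?v = middle e1 (- e1)" by (rule middle_const [OF uv']) (simp add: vec3_simps)
    then have "null_map (zorn 1 ?u ?v (- 1)) = middle e1 (- e1) + upper_map ?u + lower_map ?v"
      unfolding middle_def [of ?u ?v] by (simp add: diff_eq_eq add.commute add.left_commute)
    then have "null_map (a *s zorn 1 ?u ?v (- 1)) =
        a *s (middle e1 (- e1) + upper_map ?u + lower_map ?v)"
      unfolding null_map_scale [OF null] by simp
    also have "a *s zorn 1 ?u ?v (- 1) = x" using False by (simp add: x zorn_scale)
    finally show ?thesis using False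
      by (simp add: rep_map_def x upper_map_scale lower_map_scale vec.scale_right_distrib)
  qed
qed

lemma rep_map_one: "rep_map oct_one = 0"
  using upper_map_scale [of 0 0] lower_map_scale [of 0 0] by (simp add: rep_map_def)

text \<open>The null vectors and the unit element span the octonions.\<close>

lemma rep_map_equivariant:
  assumes g: "g \<in> G2" shows "rep_map (g *v x) = \<rho> g *v rep_map x"
proof -
  have null: "rep_map (g *v x) = \<rho> g *v rep_map x" if "null_vec x" for x
    using that g by (simp add: rep_map_null null_map_equivariant)
  obtain a u v b where x: "x = zorn a u v b" by (rule zorn_cases)
  let ?c = "(a - b) / 2"
  let ?n = "zorn 1 e1 (- e1) (- 1)" and ?u = "zorn 0 (u - ?c *s e1) 0 0" and ?v = "zorn 0 0 (v + ?c *s e1) 0"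
  have "x = ((a + b) / 2) *s oct_one + (?c *s ?n + (?u + ?v))"
    by (simp add: x zorn_add zorn_scale vec3_eq_iff field_simps)
  moreover have "null_vec ?n" "null_vec ?u" "null_vec ?v" by (simp_all add: vec3_simps)
  moreover have "rep_map (g *v oct_one) = \<rho> g *v rep_map oct_one"
    by (simp only: G2_one [OF g] rep_map_one vec.zero)
  ultimately show ?thesis
    by (simp only: vec.add vec.scale rep_map_add rep_map_scale null)
qed

end

section \<open>The trace of the representation\<close>

context lambda1_rep
begin

lemma rep_map_linear: "Vector_Spaces.linear (*s) (*s) rep_map"
  by (simp add: Vector_Spaces.linear_iff vec.vector_space_axioms rep_map_add rep_map_scale)

lemma rep_map_null_nonzero: "null_vec x \<Longrightarrow> x \<noteq> 0 \<Longrightarrow> rep_map x \<noteq> 0"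
  by (simp add: rep_map_null null_map_nonzero)

text \<open>The kernel is invariant, and no nonzero null vector lies in it. But second differences of an element
under short root groups are null vectors, and they vanish only for a diagonal element, which a first
difference excludes.\<close>

lemma rep_map_kernel:
  assumes ker: "rep_map x = 0" and tr: "oct_trace x = 0" shows "x = 0"
proof -
  obtain a u v b where "x = zorn a u v b" by (rule zorn_cases)
  with tr have x: "x = zorn a u v (- a)" by (simp add: add_eq_0_iff)
  have ker_G2: "rep_map (g *v x) = 0" if "g \<in> G2" for g
    using rep_map_equivariant [OF that, of x] ker by simp
  have diff: "rep_map (y - z) = rep_map y - rep_map z" for y z
    using rep_map_add [of "y - z" z] by simp
  \<comment> \<open>For \<open>g = u_elt w\<close> and \<open>h = u_elt (- w)\<close> the terms linear in \<open>w\<close> cancel.\<close>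
  have second: "rep_map (g *v x - x - (x - h *v x)) = 0" if "g \<in> G2" "h \<in> G2" for g h
    using that by (simp only: diff ker_G2 ker diff_0_right diff_self)
  have v: "v = 0"
  proof (rule ccontr)
    assume "v \<noteq> 0"
    then obtain w where w: "w \<odot> v = 1" using exists_dot_eq by blast
    then have "w \<noteq> 0" by (auto simp: dot_algebra)
    have "u_elt w *v x - x - (x - u_elt (- w) *v x) = zorn 0 (- 2 *s w) 0 0"
      unfolding x u_elt_zorn zorn_diff by (simp add: dot_algebra cross_algebra w) (simp add: vec3_eq_iff)
    then show False
      using second [of "u_elt w" "u_elt (- w)"] rep_map_null_nonzero [of "zorn 0 (- 2 *s w) 0 0"] \<open>w \<noteq> 0\<close>
      by (simp add: u_elt_in_G2 dot_algebra)
  qed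
  have u: "u = 0"
  proof (rule ccontr)
    assume "u \<noteq> 0"
    then obtain w where w: "w \<odot> u = 1" using exists_dot_eq by blast
    then have "w \<noteq> 0" by (auto simp: dot_algebra)
    have "v_elt w *v x - x - (x - v_elt (- w) *v x) = zorn 0 0 (- 2 *s w) 0"
      unfolding x v_elt_zorn zorn_diff by (simp add: dot_algebra cross_algebra w) (simp add: vec3_eq_iff)
    then show False
      using second [of "v_elt w" "v_elt (- w)"] rep_map_null_nonzero [of "zorn 0 0 (- 2 *s w) 0"] \<open>w \<noteq> 0\<close>
      by (simp add: v_elt_in_G2 dot_algebra)
  qed
  have "a = 0"
  proof (rule ccontr)
    assume "a \<noteq> 0"
    have "u_elt e1 *v x - x = zorn 0 ((- 2 * a) *s e1) 0 0"
      by (simp add: x u v u_elt_zorn zorn_diff dot_algebra cross_algebra vec3_eq_iff)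
    moreover have "rep_map (u_elt e1 *v x - x) = 0" by (simp add: diff ker_G2 ker u_elt_in_G2)
    ultimately show False
      using rep_map_null_nonzero [of "zorn 0 ((- 2 * a) *s e1) 0 0"] \<open>a \<noteq> 0\<close>
      by (simp add: dot_algebra vec3_eq_iff)
  qed
  then show ?thesis by (simp add: x u v)
qed

lemma rep_map_surj:
  assumes "irreducible_rep G2 \<rho>" shows "surj rep_map"
proof -
  have "vec.subspace (range rep_map)"
    unfolding vec.subspace_def
    by (auto simp flip: rep_map_add rep_map_scale) (metis rep_map_scale vec.scale_zero_left rangeI)
  moreover have "\<rho> A *v w \<in> range rep_map" if "A \<in> G2" "w \<in> range rep_map" for A w
    using that by (auto simp flip: rep_map_equivariant)
  moreover have "range rep_map \<noteq> {0}"
    using rep_map_null_nonzero [of hwv] hwv_nonzero by (auto simp: dot_algebra)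
  ultimately show ?thesis using assms unfolding irreducible_rep_def by blast
qed

text \<open>With \<open>L\<close> the matrix of \<open>rep_map\<close> and \<open>R\<close> its inverse with values in the octonions of trace zero, \<open>L R = 1\<close>
and \<open>R L = 1 - P\<close>, where \<open>P\<close> is the projection to the scalars along the trace zero part. The trace of
\<open>\<rho> g = L g R\<close> equals that of \<open>g R L = g - g P\<close>, and \<open>g P = P\<close> has trace \<open>1\<close>.\<close>

lemma trace_rep:
  assumes irr: "irreducible_rep G2 \<rho>" and g: "g \<in> G2"
  shows "trace (\<rho> g) = trace g - 1"
proof -
  let ?pr = "\<lambda>x. (oct_trace x / 2) *s oct_one"
  have section_ex: "\<exists>!x. oct_trace x = 0 \<and> rep_map x = y" for y
  proof -
    obtain x where x: "rep_map x = y" using rep_map_surj [OF irr] by (metis surjD)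
    have diff: "rep_map (x - z) = rep_map x - rep_map z" "oct_trace (x - z) = oct_trace x - oct_trace z" for x z
      using rep_map_add [of "x - z" z] by (simp_all add: oct_trace_def)
    have "oct_trace (x - ?pr x) = 0" "rep_map (x - ?pr x) = y"
      unfolding diff rep_map_scale rep_map_one oct_trace_linear by (simp_all add: x)
    moreover have "x = z" if "oct_trace x = 0" "rep_map x = y" "oct_trace z = 0" "rep_map z = y" for x z
      using rep_map_kernel [of "x - z"] that by (simp add: diff)
    ultimately show ?thesis by blast
  qed
  define r where "r y = (THE x. oct_trace x = 0 \<and> rep_map x = y)" for y
  have r: "oct_trace (r y) = 0" "rep_map (r y) = y" for y
    using theI' [OF section_ex [of y]] by (simp_all add: r_def)
  have r_unique: "x = r y" if "oct_trace x = 0" "rep_map x = y" for x y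
    using section_ex [of y] r [of y] that by blast
  have r_lin: "Vector_Spaces.linear (*s) (*s) r"
  proof -
    have "r (y + z) = r y + r z" for y z
      by (rule r_unique [symmetric]) (simp_all add: oct_trace_linear rep_map_add r)
    moreover have "r (c *s y) = c *s r y" for c y
      by (rule r_unique [symmetric]) (simp_all add: oct_trace_linear rep_map_scale r)
    ultimately show ?thesis by (simp add: Vector_Spaces.linear_iff vec.vector_space_axioms)
  qed
  let ?L = "matrix rep_map" and ?R = "matrix r" and ?P = "matrix ?pr"
  have L: "?L *v x = rep_map x" for x by (rule matrix_works [OF rep_map_linear])
  have R: "?R *v y = r y" for y by (rule matrix_works [OF r_lin])
  have pr_lin: "Vector_Spaces.linear (*s) (*s) ?pr"
    by (simp add: Vector_Spaces.linear_iff vec.vector_space_axioms oct_trace_linear add_divide_distrib vec.scale_left_distrib)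
  have P: "?P *v x = ?pr x" for x by (rule matrix_works [OF pr_lin])
  have LR: "?L ** ?R = mat 1"
    unfolding matrix_eq by (simp add: L R r flip: matrix_vector_mul_assoc)
  have RL: "?R ** ?L = mat 1 - ?P"
    unfolding matrix_eq
  proof
    fix x
    have "x - ?pr x = r (rep_map x)"
    proof (rule r_unique)
      show "oct_trace (x - ?pr x) = 0"
        by (simp add: oct_trace_def zorn_scale field_simps)
      have "rep_map (x - ?pr x) = rep_map x - rep_map (?pr x)"
        using rep_map_add [of "x - ?pr x" "?pr x"] by simp
      then show "rep_map (x - ?pr x) = rep_map x" unfolding rep_map_scale rep_map_one by simp
    qed
    then show "(?R ** ?L) *v x = (mat 1 - ?P) *v x"
      by (simp add: L R P matrix_vector_mult_diff_rdistrib flip: matrix_vector_mul_assoc)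
  qed
  have Lg: "\<rho> g ** ?L = ?L ** g"
    unfolding matrix_eq by (simp add: L rep_map_equivariant [OF g] flip: matrix_vector_mul_assoc)
  have gP: "g ** ?P = ?P"
    unfolding matrix_eq by (simp only: P vec.scale G2_one [OF g] matrix_vector_mul_assoc [symmetric]) simp
  have "trace ?P = 1"
    by (simp add: trace_def UNIV_oct_index matrix_def oct_trace_def axis_def zorn_def)
  have "trace (\<rho> g) = trace (\<rho> g ** (?L ** ?R))" by (simp add: LR)
  also have "\<dots> = trace ((?L ** g) ** ?R)" by (simp add: matrix_mul_assoc Lg)
  also have "\<dots> = trace (?R ** (?L ** g))" by (rule trace_mul_sym)
  also have "\<dots> = trace ((mat 1 - ?P) ** g)" by (simp add: matrix_mul_assoc RL)
  also have "(mat 1 - ?P) ** g = g - ?P ** g"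
    unfolding matrix_eq by (simp add: matrix_vector_mult_diff_rdistrib flip: matrix_vector_mul_assoc)
  also have "trace \<dots> = trace g - trace (?P ** g)" by (rule trace_sub)
  also have "trace (?P ** g) = 1" by (subst trace_mul_sym) (simp add: gP \<open>trace ?P = 1\<close>)
  finally show ?thesis .
qed

lemma dimension_rep:
  assumes "irreducible_rep G2 \<rho>" shows "CARD('m) = 7"
proof -
  have "of_nat (CARD('m)) = trace (mat 1 :: oct_matrix) - 1"
    using trace_rep [OF assms G2_id] by (simp add: rep_id trace_I)
  also have "\<dots> = of_nat 7" by (simp add: trace_def mat_def UNIV_oct_index)
  finally show ?thesis by (simp only: of_nat_eq_iff)
qed

end

section \<open>Similarity up to a scalar\<close>

lemma mat_scalar_vec: "mat c *v x = c *s x" for x :: "complex^'n"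
  by (simp add: vec_eq_iff matrix_vector_mult_def mat_def if_distrib [of "\<lambda>y. y * _"] cong: if_cong)

text \<open>The matrix \<open>P\<close> and the constant \<open>c\<close> are kept explicit because products and inverses are
compared with the same \<open>P\<close>, while the constants multiply.\<close>

definition scaled_conj :: "complex^'n^'n \<Rightarrow> complex \<Rightarrow> complex^'n^'n \<Rightarrow> complex^'n^'n \<Rightarrow> bool" where
  "scaled_conj P c A B \<longleftrightarrow> invertible P \<and> A ** P = P ** (mat c ** B)"

lemma conj_eq_iff:
  fixes A B P :: "complex^'n^'n"
  assumes "invertible P" shows "A = P ** B ** matrix_inv P \<longleftrightarrow> A ** P = P ** B"
  using matrix_inv_left [OF assms] matrix_inv_right [OF assms]
  by (metis matrix_mul_assoc matrix_mul_rid)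

lemma conjugate_GL_up_to_const_iff:
  "conjugate_GL_up_to_const A B \<longleftrightarrow> (\<exists>c P. c \<noteq> 0 \<and> scaled_conj P c A B)"
  by (auto simp: conjugate_GL_up_to_const_def conjugate_in_def GL_def scaled_conj_def conj_eq_iff)

lemma scaled_conj_mult:
  assumes "scaled_conj P c A B" "scaled_conj P d A' B'"
  shows "scaled_conj P (c * d) (A ** A') (B ** B')"
proof -
  have "A ** A' ** P = A ** P ** (mat d ** B')"
    using assms(2) unfolding scaled_conj_def by (metis matrix_mul_assoc)
  also have "\<dots> = P ** (mat c ** B) ** (mat d ** B')" using assms by (simp add: scaled_conj_def)
  also have "\<dots> = P ** (mat (c * d) ** (B ** B'))"
    unfolding matrix_eq by (simp add: mat_scalar_vec vec.scale flip: matrix_vector_mul_assoc)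
  finally show ?thesis using assms by (simp add: scaled_conj_def)
qed

lemma scaled_conj_inverse:
  assumes conj: "scaled_conj P c A B" and c: "c \<noteq> 0" and A: "A' ** A = mat 1" and B: "B ** B' = mat 1"
  shows "scaled_conj P (1 / c) A' B'"
proof -
  have "P ** (mat (1 / c) ** B') = A' ** (A ** P) ** (mat (1 / c) ** B')"
    by (simp add: matrix_mul_assoc A)
  also have "\<dots> = A' ** P ** ((mat c ** B) ** (mat (1 / c) ** B'))"
    using conj by (simp add: scaled_conj_def matrix_mul_assoc)
  also have "(mat c ** B) ** (mat (1 / c) ** B') = B ** B'"
    unfolding matrix_eq using c by (simp add: mat_scalar_vec vec.scale flip: matrix_vector_mul_assoc)
  finally show ?thesis using conj by (simp add: scaled_conj_def B)
qed

lemma scaled_conj_trace: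
  assumes "scaled_conj P c A B" shows "trace A = c * trace B"
proof -
  have P: "invertible P" "A ** P = P ** (mat c ** B)" using assms by (simp_all add: scaled_conj_def)
  have "trace A = trace (A ** P ** matrix_inv P)"
    by (simp add: matrix_inv_right P(1) flip: matrix_mul_assoc)
  also have "\<dots> = trace (matrix_inv P ** (P ** (mat c ** B)))" unfolding P(2) by (rule trace_mul_sym)
  also have "\<dots> = trace (mat c ** B)" by (simp add: matrix_mul_assoc matrix_inv_left P(1))
  also have "mat c ** B = (\<chi> i j. c * B$i$j)"
    by (simp add: vec_eq_iff matrix_matrix_mult_def mat_def if_distrib [of "\<lambda>y. y * _"] cong: if_cong)
  also have "trace \<dots> = c * trace B" by (simp add: trace_def sum_distrib_left)
  finally show ?thesis .
qed

lemma scaled_conj_det: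
  fixes A B :: "complex^'n^'n"
  assumes "scaled_conj P c A B" shows "det A = c ^ CARD('n) * det B"
proof -
  have P: "invertible P" "A ** P = P ** (mat c ** B)" using assms by (simp_all add: scaled_conj_def)
  have "det (mat c :: complex^'n^'n) = c ^ CARD('n)"
    by (subst det_diagonal) (simp_all add: mat_def)
  then have "det A * det P = c ^ CARD('n) * det B * det P"
    using arg_cong [OF P(2), of det] by (simp add: det_mul mult_ac)
  moreover have "det P \<noteq> 0" using P(1) invertible_det_nz by blast
  ultimately show ?thesis by simp
qed

lemma conjugate_in_G2_iff: "conjugate_in G2 A B \<longleftrightarrow> (\<exists>P\<in>G2. A ** P = P ** B)"
  by (auto simp: conjugate_in_def conj_eq_iff G2_invertible)

lemma conjugate_in_G2_trans:
  assumes "conjugate_in G2 A B" "conjugate_in G2 B C" shows "conjugate_in G2 A C"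
proof -
  obtain P Q where "P \<in> G2" "Q \<in> G2" "A ** P = P ** B" "B ** Q = Q ** C"
    using assms by (auto simp: conjugate_in_G2_iff)
  then have "P ** Q \<in> G2" "A ** (P ** Q) = (P ** Q) ** C"
    by (simp_all add: G2_compose) (metis matrix_mul_assoc)
  then show ?thesis unfolding conjugate_in_G2_iff by blast
qed

lemma conjugate_in_G2_sym:
  assumes "conjugate_in G2 A B" shows "conjugate_in G2 B A"
proof -
  obtain P where P: "P \<in> G2" "A ** P = P ** B" using assms by (auto simp: conjugate_in_G2_iff)
  then have "matrix_inv P \<in> G2" "B ** matrix_inv P = matrix_inv P ** A"
    using G2_inverse G2_invertible matrix_inv_left matrix_inv_right
    by (blast, metis matrix_mul_assoc matrix_mul_lid matrix_mul_rid)
  then show ?thesis unfolding conjugate_in_G2_iff by blast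
qed

lemma conjugate_in_G2_refl: "conjugate_in G2 A A"
  unfolding conjugate_in_G2_iff by (rule bexI [OF _ G2_id]) simp

lemma rational_rep_conjugate:
  assumes rep: "rational_rep G2 \<rho>" and G2: "s1 \<in> G2" "s2 \<in> G2" and conj: "conjugate_in G2 s1 s2"
  shows "conjugate_GL_up_to_const (\<rho> s1) (\<rho> s2)"
proof -
  obtain P where P: "P \<in> G2" "s1 ** P = P ** s2" using conj by (auto simp: conjugate_in_G2_iff)
  have hom: "\<rho> (mat 1) = mat 1" "\<And>A B. A \<in> G2 \<Longrightarrow> B \<in> G2 \<Longrightarrow> \<rho> (A ** B) = \<rho> A ** \<rho> B"
    using rep by (simp_all add: rational_rep_def)
  have "\<rho> P ** \<rho> (matrix_inv P) = mat 1" "\<rho> (matrix_inv P) ** \<rho> P = mat 1"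
    using P G2_inverse by (simp_all add: matrix_inv_left matrix_inv_right G2_invertible hom flip: hom(2))
  then have "invertible (\<rho> P)" unfolding invertible_def by blast
  moreover have "\<rho> s1 ** \<rho> P = \<rho> P ** (mat 1 ** \<rho> s2)"
    using P G2 by (simp flip: hom(2))
  ultimately show ?thesis
    unfolding conjugate_GL_up_to_const_iff scaled_conj_def by (intro exI [of _ 1] exI [of _ "\<rho> P"]) auto
qed

section \<open>Traces determine semisimple classes\<close>

lemma torus_swap: "conjugate_in G2 (torus_elt a b c) (torus_elt b a c)"
  unfolding conjugate_in_G2_iff
proof
  show "sl3_elt e2 e1 (- e3) \<in> G2" by (rule sl3_elt_in_G2) (simp add: vec3_simps)
  show "torus_elt a b c ** sl3_elt e2 e1 (- e3) = sl3_elt e2 e1 (- e3) ** torus_elt b a c"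
    by (rule oct_matrix_eqI)
      (simp add: torus_elt_zorn sl3_elt_zorn lin3_def vec3_simps flip: matrix_vector_mul_assoc)
qed

lemma torus_rotate: "conjugate_in G2 (torus_elt a b c) (torus_elt b c a)"
  unfolding conjugate_in_G2_iff
proof
  show "sl3_elt e2 e3 e1 \<in> G2" by (rule sl3_elt_in_G2) (simp add: vec3_simps)
  show "torus_elt a b c ** sl3_elt e2 e3 e1 = sl3_elt e2 e3 e1 ** torus_elt b c a"
    by (rule oct_matrix_eqI)
      (simp add: torus_elt_zorn sl3_elt_zorn lin3_def vec3_simps flip: matrix_vector_mul_assoc)
qed

lemma torus_invert: "conjugate_in G2 (torus_elt a b c) (torus_elt (1 / a) (1 / b) (1 / c))"
  unfolding conjugate_in_G2_iff
proof
  show "torus_elt a b c ** swap_elt = swap_elt ** torus_elt (1 / a) (1 / b) (1 / c)"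
    by (rule oct_matrix_eqI)
      (simp add: torus_elt_zorn swap_elt_zorn vec3_eq_iff flip: matrix_vector_mul_assoc)
qed (rule swap_elt_in_G2)

lemma trace_torus: "trace (torus_elt a b c) = 2 + (a + b + c) + (1 / a + 1 / b + 1 / c)"
proof -
  have "torus_elt a b c $ i $ i = (torus_elt a b c *v axis i 1) $ i" for i
    by (simp add: matrix_axis)
  then show ?thesis
    by (simp add: trace_def torus_elt_works UNIV_oct_index axis_def)
qed

text \<open>Equal elementary symmetric functions mean equal triples up to order; the permutations of the \<open>t\<^sub>i\<close>
are generated by a transposition and a rotation.\<close>

lemma torus_conj_of_symmetric_eq:
  fixes a b c :: complex
  assumes s1: "a + b + c = a' + b' + c'" and s2: "a * b + b * c + c * a = a' * b' + b' * c' + c' * a'"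
    and s3: "a * b * c = a' * b' * c'"
  shows "conjugate_in G2 (torus_elt a b c) (torus_elt a' b' c')"
proof -
  have two: "conjugate_in G2 (torus_elt a b c) (torus_elt a y z)"
    if "b + c = y + z" "b * c = y * z" for a b c y z
  proof -
    have "(b - y) * (b - z) = b * b - b * (y + z) + y * z" by (simp add: algebra_simps)
    also have "\<dots> = 0" unfolding that [symmetric] by (simp add: algebra_simps)
    finally consider "b = y" | "b = z" by auto
    then show ?thesis
    proof cases
      case 1 then show ?thesis using that conjugate_in_G2_refl by simp
    next
      case 2
      then have "c = y" using that by simp
      with 2 show ?thesis
        using torus_swap [of b a c] torus_rotate [of a c b] torus_rotate torus_swap conjugate_in_G2_trans by metis
    qed
  qed
  have root: "conjugate_in G2 (torus_elt a b c) (torus_elt x y z)"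
    if "a + b + c = x + y + z" "a * b + b * c + c * a = x * y + y * z + z * x" "a * b * c = x * y * z" "a = x" for x y z
  proof -
    have bc: "b + c = y + z" using that by simp
    have "b * c = (a * b + b * c + c * a) - a * (b + c)" by (simp add: algebra_simps)
    also have "\<dots> = y * z" unfolding bc that(2) by (simp add: that(4) algebra_simps)
    finally show ?thesis using two [OF bc] that(4) by simp
  qed
  have "(a - a') * (a - b') * (a - c') =
      a^3 - (a' + b' + c') * a^2 + (a' * b' + b' * c' + c' * a') * a - a' * b' * c'"
    by (simp add: algebra_simps power2_eq_square power3_eq_cube)
  also have "\<dots> = 0" unfolding s1 [symmetric] s2 [symmetric] s3 [symmetric]
    by (simp add: algebra_simps power2_eq_square power3_eq_cube)
  finally consider "a = a'" | "a = b'" | "a = c'" by auto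
  then show ?thesis
  proof cases
    case 1 then show ?thesis using root assms by blast
  next
    case 2
    then have "conjugate_in G2 (torus_elt a b c) (torus_elt b' c' a')"
      using assms by (intro root) (simp_all add: algebra_simps)
    then show ?thesis using torus_rotate conjugate_in_G2_trans by blast
  next
    case 3
    then have "conjugate_in G2 (torus_elt a b c) (torus_elt c' a' b')"
      using assms by (intro root) (simp_all add: algebra_simps)
    then show ?thesis using torus_rotate conjugate_in_G2_trans by blast
  qed
qed

text \<open>The sums \<open>p\<close> of the entries and \<open>q\<close> of their inverses are determined up to exchange, since \<open>p + q\<close>
and \<open>p\<^sup>2 + q\<^sup>2\<close> are known. Exchanging \<open>p\<close> and \<open>q\<close> is inverting the element.\<close>

lemma torus_conj_of_trace_eq:
  assumes abc: "a * b * c = 1" and abc': "a' * b' * c' = 1"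
    and tr: "trace (torus_elt a b c) = trace (torus_elt a' b' c')"
    and tr2: "trace (torus_elt a b c ** torus_elt a b c) = trace (torus_elt a' b' c' ** torus_elt a' b' c')"
  shows "conjugate_in G2 (torus_elt a b c) (torus_elt a' b' c')"
proof -
  have inv: "1 / a = b * c" "1 / b = c * a" "1 / c = a * b" if "a * b * c = 1" for a b c :: complex
  proof -
    have "a \<noteq> 0" "b \<noteq> 0" "c \<noteq> 0" using that by auto
    then show "1 / a = b * c" "1 / b = c * a" "1 / c = a * b"
      using that by (simp_all add: divide_eq_eq mult_ac)
  qed
  let ?p = "a + b + c" and ?q = "a * b + b * c + c * a"
  let ?p' = "a' + b' + c'" and ?q' = "a' * b' + b' * c' + c' * a'"
  have sq: "trace (torus_elt a b c ** torus_elt a b c) =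
      2 + (a + b + c)^2 - 2 * (a * b + b * c + c * a) + (a * b + b * c + c * a)^2 - 2 * (a + b + c)"
    if "a * b * c = 1" for a b c
  proof -
    have "1 / (a * a) = (b * c)^2" "1 / (b * b) = (c * a)^2" "1 / (c * c) = (a * b)^2"
      unfolding inv [OF that, symmetric] by (simp_all add: power2_eq_square)
    moreover have "(a * b) * (b * c) + (b * c) * (c * a) + (c * a) * (a * b) = (a * b * c) * (a + b + c)"
      by (simp add: algebra_simps)
    ultimately show ?thesis using that
      by (simp add: torus_elt_mult trace_torus) (simp add: power2_eq_square algebra_simps)
  qed
  have sum: "?p + ?q = ?p' + ?q'"
    using tr by (simp add: trace_torus inv [OF abc] inv [OF abc'] algebra_simps)
  have sum2: "?p^2 + ?q^2 = ?p'^2 + ?q'^2"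
    using tr2 sum unfolding sq [OF abc] sq [OF abc'] by algebra
  \<comment> \<open>Both unordered pairs have the same sum and the same product.\<close>
  have "(?p - ?p') * (?p - ?q') = 0"
    using sum sum2 by algebra
  then consider "?p = ?p'" | "?p = ?q'" by auto
  then show ?thesis
  proof cases
    case 1
    with sum have "?q = ?q'" by simp
    with 1 show ?thesis using abc abc' by (intro torus_conj_of_symmetric_eq) simp_all
  next
    case 2
    with sum have q: "?q = ?p'" by (metis add.commute add_left_cancel)
    have "conjugate_in G2 (torus_elt a b c) (torus_elt (1 / a') (1 / b') (1 / c'))"
    proof (rule torus_conj_of_symmetric_eq)
      show "?p = 1 / a' + 1 / b' + 1 / c'" unfolding 2 inv [OF abc'] by simp
      have "(1 / a') * (1 / b') + (1 / b') * (1 / c') + (1 / c') * (1 / a') = (a' * b' * c') * ?p'"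
        unfolding inv [OF abc'] by (simp add: algebra_simps)
      then show "?q = (1 / a') * (1 / b') + (1 / b') * (1 / c') + (1 / c') * (1 / a')"
        unfolding q abc' by (simp only: mult_1_left)
      show "a * b * c = (1 / a') * (1 / b') * (1 / c')" using abc abc' by simp
    qed
    then show ?thesis using torus_invert conjugate_in_G2_sym conjugate_in_G2_trans by blast
  qed
qed

lemma semisimple_conj_of_trace_eq:
  assumes "s1 \<in> G2" "semisimple_elt s1" "s2 \<in> G2" "semisimple_elt s2"
    and tr: "trace s1 = trace s2" "trace (s1 ** s1) = trace (s2 ** s2)"
  shows "conjugate_in G2 s1 s2"
proof -
  have torus: "\<exists>a b c. a * b * c = 1 \<and> conjugate_in G2 s (torus_elt a b c) \<and>
      trace s = trace (torus_elt a b c) \<and> trace (s ** s) = trace (torus_elt a b c ** torus_elt a b c)"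
    if s: "s \<in> G2" "semisimple_elt s" for s
  proof -
    obtain g a b c where g: "g \<in> G2" "a * b * c = 1" "s = g ** torus_elt a b c ** matrix_inv g"
      using semisimple_conj_torus [OF s] by metis
    have sc: "scaled_conj g 1 s (torus_elt a b c)"
      using g(1) unfolding scaled_conj_def g(3)
      by (simp add: matrix_inv_left G2_invertible flip: matrix_mul_assoc)
    have "conjugate_in G2 s (torus_elt a b c)" unfolding conjugate_in_def using g by blast
    moreover have "trace s = trace (torus_elt a b c)" using scaled_conj_trace [OF sc] by simp
    moreover have "trace (s ** s) = trace (torus_elt a b c ** torus_elt a b c)"
      using scaled_conj_trace [OF scaled_conj_mult [OF sc sc]] by simp
    ultimately show ?thesis using g(2) by blast
  qed
  obtain a b c where 1: "a * b * c = 1" "conjugate_in G2 s1 (torus_elt a b c)"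
      "trace s1 = trace (torus_elt a b c)" "trace (s1 ** s1) = trace (torus_elt a b c ** torus_elt a b c)"
    using torus assms by metis
  obtain a' b' c' where 2: "a' * b' * c' = 1" "conjugate_in G2 s2 (torus_elt a' b' c')"
      "trace s2 = trace (torus_elt a' b' c')" "trace (s2 ** s2) = trace (torus_elt a' b' c' ** torus_elt a' b' c')"
    using torus assms by metis
  have "conjugate_in G2 (torus_elt a b c) (torus_elt a' b' c')"
    by (rule torus_conj_of_trace_eq) (use 1 2 tr in simp_all)
  then show ?thesis using 1(2) 2(2) conjugate_in_G2_sym conjugate_in_G2_trans by blast
qed

lemma semisimple_conj_inverse:
  assumes s: "s \<in> G2" "semisimple_elt s" shows "conjugate_in G2 s (matrix_inv s)"
proof -
  obtain g a b c where g: "g \<in> G2" "a * b * c = 1" "s = g ** torus_elt a b c ** matrix_inv g"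
    using semisimple_conj_torus [OF s] by metis
  let ?t = "torus_elt a b c" and ?t' = "torus_elt (1 / a) (1 / b) (1 / c)"
  have nz: "a \<noteq> 0" "b \<noteq> 0" "c \<noteq> 0" using g by auto
  have tt: "?t ** ?t' = mat 1" using nz by (simp add: torus_elt_mult torus_elt_1)
  have "s ** (g ** ?t' ** matrix_inv g) = g ** ?t ** (matrix_inv g ** g) ** ?t' ** matrix_inv g"
    by (simp add: g(3) matrix_mul_assoc)
  also have "\<dots> = g ** (?t ** ?t') ** matrix_inv g"
    by (simp add: matrix_inv_left G2_invertible g(1) matrix_mul_assoc)
  also have "\<dots> = mat 1" by (simp add: tt matrix_inv_right G2_invertible g(1))
  finally have "matrix_inv s = g ** ?t' ** matrix_inv g" by (rule matrix_inv_unique)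
  then have "conjugate_in G2 (matrix_inv s) ?t'" "conjugate_in G2 s ?t"
    unfolding conjugate_in_def using g by blast+
  then show ?thesis
    by (meson torus_invert [of a b c] conjugate_in_G2_sym conjugate_in_G2_trans)
qed

context lambda1_rep
begin

lemma det_rep_conj:
  assumes "A \<in> G2" "B \<in> G2" "conjugate_in G2 A B" shows "det (\<rho> A) = det (\<rho> B)"
proof -
  obtain P where P: "P \<in> G2" "A ** P = P ** B" using assms by (auto simp: conjugate_in_G2_iff)
  then have "\<rho> A ** \<rho> P = \<rho> P ** \<rho> B" using assms by (simp flip: rep_mult)
  then have "det (\<rho> A) * det (\<rho> P) = det (\<rho> B) * det (\<rho> P)"
    by (metis det_mul mult.commute)
  moreover have "det (\<rho> P) * det (\<rho> (matrix_inv P)) = 1"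
    using P G2_inverse by (simp add: matrix_inv_right G2_invertible rep_id flip: det_mul rep_mult)
  ultimately show ?thesis by auto
qed

text \<open>The element is the square of a torus element \<open>r\<close>, and \<open>r\<close> is conjugate to its inverse, so
\<open>det (\<rho> r)\<^sup>2 = 1\<close>.\<close>

lemma det_rep_torus:
  assumes "a * b * c = 1" shows "det (\<rho> (torus_elt a b c)) = 1"
proof -
  have nz: "a \<noteq> 0" "b \<noteq> 0" "c \<noteq> 0" using assms by auto
  define x y where "x = csqrt a" and "y = csqrt b"
  have xy: "x \<noteq> 0" "y \<noteq> 0" "x * x = a" "y * y = b"
    using nz by (simp_all add: x_def y_def flip: power2_eq_square)
  let ?r = "torus_elt x y (1 / (x * y))" and ?r' = "torus_elt (1 / x) (1 / y) (1 / (1 / (x * y)))"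
  have G2: "?r \<in> G2" "?r' \<in> G2" using xy by (intro torus_elt_in_G2; simp)+
  have c: "c = 1 / (x * y) * (1 / (x * y))" using assms nz unfolding xy(3,4) [symmetric] by (simp add: field_simps)
  have "?r ** ?r = torus_elt a b c" by (simp add: torus_elt_mult xy c)
  moreover have "?r ** ?r' = mat 1" using xy by (simp add: torus_elt_mult torus_elt_1)
  moreover have "det (\<rho> ?r') = det (\<rho> ?r)"
    using det_rep_conj [OF G2 torus_invert] by simp
  ultimately show ?thesis using G2 by (metis det_I det_mul rep_id rep_mult)
qed

lemma det_rep_semisimple:
  assumes s: "s \<in> G2" "semisimple_elt s" shows "det (\<rho> s) = 1"
proof -
  obtain g a b c where g: "g \<in> G2" "a * b * c = 1" "s = g ** torus_elt a b c ** matrix_inv g"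
    using semisimple_conj_torus [OF s] by metis
  then have "conjugate_in G2 s (torus_elt a b c)" unfolding conjugate_in_def by blast
  then show ?thesis using det_rep_conj det_rep_torus s g(2) torus_elt_in_G2 by metis
qed

theorem rep_separates_semisimple:
  assumes irr: "irreducible_rep G2 \<rho>"
    and s1: "s1 \<in> G2" "semisimple_elt s1" and s2: "s2 \<in> G2" "semisimple_elt s2"
    and conj: "conjugate_GL_up_to_const (\<rho> s1) (\<rho> s2)"
  shows "conjugate_in G2 s1 s2"
proof -
  obtain c P where c: "c \<noteq> 0" and sc: "scaled_conj P c (\<rho> s1) (\<rho> s2)"
    using conj by (auto simp: conjugate_GL_up_to_const_iff)
  let ?i1 = "matrix_inv s1" and ?i2 = "matrix_inv s2"
  have inv: "?i1 \<in> G2" "?i2 \<in> G2" using G2_inverse s1 s2 by auto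
  have sci: "scaled_conj P (1 / c) (\<rho> ?i1) (\<rho> ?i2)"
    by (rule scaled_conj_inverse [OF sc c])
      (simp_all add: matrix_inv_left matrix_inv_right G2_invertible s1 s2 inv rep_id flip: rep_mult)
  let ?tr = "\<lambda>s. trace s - 1"
  have tr_conj: "trace A = trace B" "trace (A ** A) = trace (B ** B)" if conj: "conjugate_in G2 A B" for A B
  proof -
    obtain P where "P \<in> G2" "A ** P = P ** B" using conj by (auto simp: conjugate_in_G2_iff)
    then have "scaled_conj P 1 A B" by (simp add: scaled_conj_def G2_invertible)
    from scaled_conj_trace [OF this] scaled_conj_trace [OF scaled_conj_mult [OF this this]]
    show "trace A = trace B" "trace (A ** A) = trace (B ** B)" by simp_all
  qed
  note inv_trace = tr_conj [OF semisimple_conj_inverse [OF s1]] tr_conj [OF semisimple_conj_inverse [OF s2]]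
  have t1: "?tr s1 = c * ?tr s2" and t1': "?tr s1 = 1 / c * ?tr s2"
    using scaled_conj_trace [OF sc] scaled_conj_trace [OF sci]
    by (simp_all add: trace_rep irr s1 s2 inv inv_trace)
  have t2: "?tr (s1 ** s1) = c * c * ?tr (s2 ** s2)" and t2': "?tr (s1 ** s1) = 1 / c * (1 / c) * ?tr (s2 ** s2)"
    using scaled_conj_trace [OF scaled_conj_mult [OF sc sc]] scaled_conj_trace [OF scaled_conj_mult [OF sci sci]]
    by (simp_all add: trace_rep irr s1 s2 inv inv_trace G2_compose flip: rep_mult)
  have c7: "c ^ 7 = 1"
    using scaled_conj_det [OF sc] by (simp add: det_rep_semisimple s1 s2 dimension_rep [OF irr])
  \<comment> \<open>Here \<open>c = c\<^sup>8\<close>, a power of \<open>c\<^sup>4\<close>.\<close>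
  have one: "c = 1" if "c * c = 1 \<or> c * c * (c * c) = 1"
  proof -
    have "c = c ^ 7 * c" by (simp add: c7)
    also have "\<dots> = (c * c * (c * c)) * (c * c * (c * c))" by (simp add: eval_nat_numeral mult_ac)
    also have "\<dots> = 1" using that by auto
    finally show ?thesis .
  qed
  have "trace s1 = trace s2"
  proof (cases "?tr s2 = 0")
    case True then show ?thesis using t1 by simp
  next
    case False
    have "c * ?tr s2 = 1 / c * ?tr s2" using t1 t1' by simp
    then have "c = 1 / c" using False by (metis mult_right_cancel)
    then have "c * c = 1" using c by (simp add: field_simps)
    then show ?thesis using one t1 by simp
  qed
  moreover have "trace (s1 ** s1) = trace (s2 ** s2)"
  proof (cases "?tr (s2 ** s2) = 0")
    case True then show ?thesis using t2 by simp
  next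
    case False
    have "c * c * ?tr (s2 ** s2) = 1 / c * (1 / c) * ?tr (s2 ** s2)" using t2 t2' by simp
    then have "c * c = 1 / c * (1 / c)" using False by (metis mult_right_cancel)
    then have "c * c * (c * c) = 1" using c by (simp add: field_simps)
    then show ?thesis using one t2 by simp
  qed
  ultimately show ?thesis by (rule semisimple_conj_of_trace_eq [OF s1 s2])
qed

end

theorem proposition3p11:
  fixes \<rho>1 :: "oct_matrix \<Rightarrow> complex^'m^'m"
    and \<rho>2 :: "oct_matrix \<Rightarrow> complex^'n^'n"
    and s1 s2 :: oct_matrix
  assumes "fundamental_rep 1 \<rho>1" and "fundamental_rep 2 \<rho>2"
    and "s1 \<in> G2" and "s2 \<in> G2"
    and "semisimple_elt s1" and "semisimple_elt s2"
  shows "conjugate_in G2 s1 s2 \<longleftrightarrow>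
    conjugate_GL_up_to_const (\<rho>1 s1) (\<rho>1 s2) \<and>
    conjugate_GL_up_to_const (\<rho>2 s1) (\<rho>2 s2)"
proof
  assume "conjugate_in G2 s1 s2"
  then show "conjugate_GL_up_to_const (\<rho>1 s1) (\<rho>1 s2) \<and> conjugate_GL_up_to_const (\<rho>2 s1) (\<rho>2 s2)"
    using rational_rep_conjugate assms(1,2) assms(3,4) unfolding fundamental_rep_def by metis
next
  assume conj: "conjugate_GL_up_to_const (\<rho>1 s1) (\<rho>1 s2) \<and> conjugate_GL_up_to_const (\<rho>2 s1) (\<rho>2 s2)"
  obtain v where "lambda1_rep \<rho>1 v"
    using assms(1) unfolding fundamental_rep_def has_highest_weight_def lambda1_rep_def by blast
  then show "conjugate_in G2 s1 s2"
    by (rule lambda1_rep.rep_separates_semisimple) (use assms conj in \<open>auto simp: fundamental_rep_def\<close>)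
qed

end
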